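(* Let $k$ be a field of characteristic zero, let $R = k[x_1,x_2,x_3,x_4]$, let $a_2,a_3,a_4,a_5$ be positive integers, let $L \in R$ be a general linear form, and let $I = \langle x_1^{2}, x_2^{a_2}, x_3^{a_3}, x_4^{a_4}, L^{a_5} \rangle \subset R$. Then the algebra $R/I$ has the WLP.
   Context: "General linear form" means that the assertion holds for all linear forms whose coefficient vector lies in some nonempty Zariski-open subset of the space of linear forms $[R]_1$. A standard graded artinian $k$-algebra $A = R/I$ has the Weak Lefschetz Property (WLP) if, for a general linear form $\ell \in R$, the multiplication map $\times \ell : [A]_{t} \to [A]_{t+1}$ has maximal rank (i.e. is injective or surjective) for every integer $t$. *)

theory Defs
  imports
    "HOL-Analysis.Analysis"
    "HOL-Library.Poly_Mapping"
    "HOL-Algebra.QuotRing"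
begin

text \<open>
  Polynomials in variables indexed by a type 'n over a field 'k are finitely supported
  functions from exponent vectors to coefficients; multiplication is convolution.
\<close>

type_synonym ('n, 'k) mpoly = "('n \<Rightarrow>\<^sub>0 nat) \<Rightarrow>\<^sub>0 'k"

definition Var :: "'n \<Rightarrow> ('n, 'k::field) mpoly" where
  "Var i = Poly_Mapping.single (Poly_Mapping.single i 1) 1"

definition eval_mpoly :: "('n::finite, 'k::field) mpoly \<Rightarrow> ('n \<Rightarrow> 'k) \<Rightarrow> 'k" where
  "eval_mpoly f c =
     (\<Sum>m\<in>Poly_Mapping.keys f. Poly_Mapping.lookup f m * (\<Prod>i\<in>UNIV. c i ^ Poly_Mapping.lookup m i))"

definition mdeg :: "('n::finite \<Rightarrow>\<^sub>0 nat) \<Rightarrow> nat" where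
  "mdeg m = (\<Sum>i\<in>UNIV. Poly_Mapping.lookup m i)"

text \<open>The component of degree \<open>t\<close> of the polynomial ring; it is zero for negative \<open>t\<close>.\<close>

definition graded_piece :: "int \<Rightarrow> ('n::finite, 'k::field) mpoly set" where
  "graded_piece t = {f. \<forall>m\<in>Poly_Mapping.keys f. int (mdeg m) = t}"

definition linear_form :: "('n::finite \<Rightarrow> 'k) \<Rightarrow> ('n, 'k::field) mpoly" where
  "linear_form c = (\<Sum>i\<in>UNIV. Poly_Mapping.single (Poly_Mapping.single i 1) (c i))"

definition zariski_closed :: "('n::finite \<Rightarrow> 'k::field) set \<Rightarrow> bool" where
  "zariski_closed Z \<longleftrightarrow> (\<exists>S. Z = {c. \<forall>f\<in>S. eval_mpoly f c = 0})"

definition zariski_open :: "('n::finite \<Rightarrow> 'k::field) set \<Rightarrow> bool" where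
  "zariski_open U \<longleftrightarrow> zariski_closed (- U)"

definition for_general_linear_form :: "(('n::finite, 'k::field) mpoly \<Rightarrow> bool) \<Rightarrow> bool" where
  "for_general_linear_form P \<longleftrightarrow>
     (\<exists>U. zariski_open U \<and> U \<noteq> {} \<and> (\<forall>c\<in>U. P (linear_form c)))"

text \<open>The type-class polynomial ring as a ring record, to form ideals and quotients.\<close>

definition poly_ring :: "('n, 'k::field) mpoly ring" where
  "poly_ring = \<lparr>carrier = UNIV, mult = (*), one = 1, zero = 0, add = (+)\<rparr>"

lemma cring_poly_ring: "cring (poly_ring :: ('n, 'k::field) mpoly ring)"
proof (rule cringI)
  show "abelian_group (poly_ring :: ('n, 'k) mpoly ring)"
  proof (rule abelian_groupI)
    fix x :: "('n, 'k) mpoly"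
    show "\<exists>y\<in>carrier poly_ring. y \<oplus>\<^bsub>poly_ring\<^esub> x = \<zero>\<^bsub>poly_ring\<^esub>"
      by (rule bexI[of _ "- x"]) (simp_all add: poly_ring_def)
  qed (simp_all add: poly_ring_def algebra_simps)
  show "Group.comm_monoid (poly_ring :: ('n, 'k) mpoly ring)"
    by (rule comm_monoidI) (simp_all add: poly_ring_def algebra_simps)
qed (simp add: poly_ring_def algebra_simps)

definition quot_piece :: "('n::finite, 'k::field) mpoly set \<Rightarrow> int \<Rightarrow> ('n, 'k) mpoly set set" where
  "quot_piece I t = (\<lambda>f. I +>\<^bsub>poly_ring\<^esub> f) ` graded_piece t"

definition quot_times :: "('n::finite, 'k::field) mpoly set \<Rightarrow> ('n, 'k) mpoly \<Rightarrow>
    ('n, 'k) mpoly set \<Rightarrow> ('n, 'k) mpoly set" where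
  "quot_times I l u = (I +>\<^bsub>poly_ring\<^esub> l) \<otimes>\<^bsub>poly_ring Quot I\<^esub> u"

text \<open>
  The weak Lefschetz property of the polynomial ring modulo \<open>I\<close>. It is meant for homogeneous
  ideals \<open>I\<close> with artinian quotient, such as those containing a power of every variable.
\<close>

definition has_WLP :: "('n::finite, 'k::field) mpoly set \<Rightarrow> bool" where
  "has_WLP I \<longleftrightarrow> for_general_linear_form (\<lambda>l. \<forall>t.
     inj_on (quot_times I l) (quot_piece I t) \<or>
     quot_times I l ` quot_piece I t = quot_piece I (t + 1))"

end

theory Submission
  imports Defs
begin

text \<open>
  Let \<open>I\<close> be the ideal of the theorem, \<open>l\<close> a general linear form and \<open>\<lambda>\<^sub>1, \<dots>, \<lambda>\<^sub>4\<close> the forms \<open>L\<close>, \<open>Var 2\<close>,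
  \<open>Var 3\<close>, \<open>Var 4\<close>, so that \<open>I\<close> is generated by \<open>(Var 1)\<^sup>2\<close> and powers \<open>\<lambda>\<^sub>k\<close> to the \<open>a\<^sub>k\<close>. Write \<open>d\<^sub>s\<close> for the
  dimension in degree \<open>s\<close> of the polynomial ring modulo \<open>I\<close> and \<open>l\<close>, and \<open>e\<^sub>s\<close> for the naive count
  \<open>2 s + 1 - (\<Sum>k. (2 (s - a\<^sub>k) + 1))\<close>, where the sum is over all \<open>k\<close> with \<open>a\<^sub>k \<le> s\<close>.

  The key point is that \<open>d\<^sub>s = 0\<close> or \<open>d\<^sub>s \<le> e\<^sub>s\<close> (\<open>expected_codim\<close>). Modulo \<open>l\<close> there are three variables, and
  a constant-coefficient derivation that kills \<open>Var 1\<close> and one \<open>\<lambda>\<^sub>i\<close> relates the ideal in degree \<open>s\<close> to the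
  ideal in degree \<open>s - 1\<close> in which the exponents other than \<open>a\<^sub>i\<close> are smaller by one. Since one generator is
  the square of a linear form, the kernel of the derivation modulo \<open>(Var 1)\<^sup>2\<close> and \<open>l\<close> is at most
  two-dimensional in each degree, and an induction on the degree closes.

  The rest is counting. The numbers \<open>e\<^sub>0 + \<dots> + e\<^sub>n\<close> add up to \<open>(n + 1)\<^sup>2 - (\<Sum>k. (n - a\<^sub>k + 1)\<^sup>2)\<close>, over all \<open>k\<close>
  with \<open>a\<^sub>k \<le> n\<close>, which is an obvious lower bound for the dimension of the ring modulo \<open>I\<close> in degree \<open>n\<close>
  (\<open>quotient_dim_lower_bound\<close>). Multiplication by \<open>l\<close> from degree \<open>t\<close> to degree \<open>t + 1\<close> is surjective if
  \<open>d\<close> vanishes at \<open>t + 1\<close>. Otherwise \<open>d\<^sub>s\<close> is nonzero, hence at most \<open>e\<^sub>s\<close>, for all \<open>s \<le> t + 1\<close>. The dimension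
  in degree \<open>t + 1\<close> is at most the sum of the \<open>d\<^sub>s\<close>, with equality only if multiplication by \<open>l\<close> is injective
  in degree \<open>t\<close>, and at least the sum of the \<open>e\<^sub>s\<close>; so injectivity follows (\<open>multiplication_max_rank\<close>).

  All that is needed of \<open>L\<close> is that its coefficients are nonzero, and of \<open>l\<close> that moreover its \<open>2 \<times> 2\<close> minors
  with \<open>L\<close> are nonzero; both are Zariski open conditions.
\<close>

section \<open>The polynomial ring as a vector space\<close>

definition smul :: "'k::field \<Rightarrow> ('n, 'k) mpoly \<Rightarrow> ('n, 'k) mpoly" where
  "smul c f = Poly_Mapping.single 0 c * f"

interpretation mp: vector_space "smul :: 'k::field \<Rightarrow> ('n, 'k) mpoly \<Rightarrow> ('n, 'k) mpoly"
  by unfold_locales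
    (simp_all add: smul_def algebra_simps single_add mult_single flip: mult.assoc)

lemma smul_mult_left [simp]: "smul c f * g = smul c (f * g)"
  by (simp add: smul_def mult.assoc)

lemma smul_mult_right [simp]: "f * smul c g = smul c (f * g)"
  by (simp add: smul_def mult.left_commute)

lemma smul_single: "smul c (Poly_Mapping.single m b) = Poly_Mapping.single m (c * b)"
  by (simp add: smul_def mult_single)

lemma lookup_smul [simp]: "Poly_Mapping.lookup (smul c f) m = c * Poly_Mapping.lookup f m"
proof -
  have "smul c f = Poly_Mapping.map ((*) c) f"
    by (simp add: smul_def mult_map_scale_conv_mult)
  thus ?thesis by (simp add: Poly_Mapping.map.rep_eq when_def)
qed

lemma keys_smul: "Poly_Mapping.keys (smul c f) \<subseteq> Poly_Mapping.keys f"
  by (auto simp: in_keys_iff)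

section \<open>Forms\<close>

text \<open>
  The graded pieces in nonnegative degrees, indexed by natural numbers to allow induction on the degree.
\<close>

definition forms :: "nat \<Rightarrow> ('n::finite, 'k::field) mpoly set" where
  "forms n = graded_piece (int n)"

lemma forms_iff: "f \<in> forms n \<longleftrightarrow> (\<forall>m\<in>Poly_Mapping.keys f. mdeg m = n)"
  by (simp add: forms_def graded_piece_def)

abbreviation monom :: "('n \<Rightarrow>\<^sub>0 nat) \<Rightarrow> ('n, 'k::field) mpoly" where
  "monom m \<equiv> Poly_Mapping.single m 1"

lemma monom_inj: "(monom m :: ('n, 'k::field) mpoly) = monom m' \<Longrightarrow> m = m'"
  by (metis lookup_single_eq lookup_single_not_eq one_neq_zero)

lemma mdeg_add [simp]: "mdeg (m + m') = mdeg m + mdeg m'"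
  by (simp add: mdeg_def lookup_add sum.distrib)

lemma mdeg_single [simp]: "mdeg (Poly_Mapping.single i e) = e"
  by (simp add: mdeg_def lookup_single when_def)

lemma mdeg_zero [simp]: "mdeg 0 = 0"
  by (simp add: mdeg_def)

lemma mdeg_eq_0_iff: "mdeg m = 0 \<longleftrightarrow> m = 0"
  by (auto simp: mdeg_def poly_mapping_eq_iff fun_eq_iff)

lemma subspace_forms: "mp.subspace (forms n :: ('n::finite, 'k::field) mpoly set)"
  unfolding mp.subspace_def
proof (intro conjI ballI allI impI)
  show "0 \<in> forms n" by (simp add: forms_iff)
next
  fix f g :: "('n, 'k) mpoly" assume "f \<in> forms n" "g \<in> forms n"
  thus "f + g \<in> forms n"
    using keys_add[of f g] by (auto simp: forms_iff)
next
  fix c and f :: "('n, 'k) mpoly" assume "f \<in> forms n"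
  thus "smul c f \<in> forms n"
    using keys_smul[of c f] by (auto simp: forms_iff)
qed

lemma monom_decomp:
  "f = (\<Sum>m\<in>Poly_Mapping.keys f. smul (Poly_Mapping.lookup f m) (monom m))"
  by (rule poly_mapping_eqI)
     (auto simp: lookup_sum smul_single lookup_single when_def in_keys_iff)

lemma forms_eq_span:
  "(forms n :: ('n::finite, 'k::field) mpoly set) = mp.span {monom m |m. mdeg m = n}"
proof
  show "(forms n :: ('n, 'k) mpoly set) \<subseteq> mp.span {monom m |m. mdeg m = n}"
  proof
    fix f :: "('n, 'k) mpoly" assume "f \<in> forms n"
    hence "(\<Sum>m\<in>Poly_Mapping.keys f. smul (Poly_Mapping.lookup f m) (monom m))
        \<in> mp.span {monom m |m. mdeg m = n}"
      by (intro mp.span_sum mp.span_scale mp.span_base) (auto simp: forms_iff)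
    thus "f \<in> mp.span {monom m |m. mdeg m = n}" by (simp flip: monom_decomp)
  qed
  show "mp.span {monom m |m. mdeg m = n} \<subseteq> (forms n :: ('n, 'k) mpoly set)"
    by (rule mp.span_minimal[OF _ subspace_forms]) (auto simp: forms_iff)
qed

lemma span_monoms: "mp.span (range monom) = UNIV"
proof -
  have "f \<in> mp.span (range monom)" for f :: "('a, 'b) mpoly"
    by (subst monom_decomp) (intro mp.span_sum mp.span_scale mp.span_base, auto)
  thus ?thesis by auto
qed

lemma independent_monoms: "mp.independent (range (monom :: _ \<Rightarrow> ('n, 'k::field) mpoly))"
proof
  assume "mp.dependent (range (monom :: _ \<Rightarrow> ('n, 'k) mpoly))"
  then obtain t and u :: "('n, 'k) mpoly \<Rightarrow> 'k" and v where t: "finite t" "t \<subseteq> range monom"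
    "(\<Sum>v\<in>t. smul (u v) v) = 0" "v \<in> t" "u v \<noteq> 0"
    unfolding mp.dependent_explicit by blast
  then obtain m where m: "v = monom m" by auto
  have "Poly_Mapping.lookup (\<Sum>w\<in>t. smul (u w) w) m = (\<Sum>w\<in>t. if w = v then u w else 0)"
    unfolding lookup_sum
  proof (rule sum.cong)
    fix w assume "w \<in> t"
    then obtain m' where "w = monom m'" using t by auto
    thus "Poly_Mapping.lookup (smul (u w) w) m = (if w = v then u w else 0)"
      using m by (cases "m' = m") (auto simp: lookup_single dest!: monom_inj)
  qed simp
  also have "\<dots> = u v" using t by simp
  finally show False using t by simp
qed

lemma forms_mult: "f \<in> forms m \<Longrightarrow> g \<in> forms n \<Longrightarrow> f * g \<in> forms (m + n)"
  using keys_mult[of f g] by (fastforce simp: forms_iff)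

lemma one_in_forms [simp]: "1 \<in> forms 0"
  by (simp add: forms_iff)

lemma forms_0: "f \<in> forms 0 \<Longrightarrow> \<exists>c. f = smul c 1"
proof -
  assume "f \<in> forms 0"
  hence "f \<in> mp.span {1}"
    unfolding forms_eq_span by (simp add: mdeg_eq_0_iff)
  thus ?thesis by (auto simp: mp.span_singleton)
qed

lemma forms_power: "f \<in> forms d \<Longrightarrow> f ^ e \<in> forms (d * e)"
  by (induction e) (auto intro: forms_mult)

lemma Var_in_forms [simp]: "Var i \<in> forms (Suc 0)"
  by (auto simp: forms_iff Var_def)

lemma linear_form_eq: "linear_form c = (\<Sum>i\<in>UNIV. smul (c i) (Var i))"
  by (simp add: linear_form_def Var_def smul_single)

lemma linear_form_in_forms [simp]: "linear_form c \<in> forms (Suc 0)"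
  unfolding linear_form_eq
  by (intro mp.subspace_sum subspace_forms mp.subspace_scale) simp_all

lemma monom_split:
  assumes "mdeg m = Suc n"
  obtains i m' where "(monom m :: ('n::finite,'k::field) mpoly) = Var i * monom m'" "mdeg m' = n"
proof -
  obtain i where i: "Poly_Mapping.lookup m i \<noteq> 0"
    using assms by (force simp: mdeg_def)
  define m' where "m' = m - Poly_Mapping.single i 1"
  have "m = Poly_Mapping.single i 1 + m'"
    using i by (auto simp: m'_def poly_mapping_eq_iff fun_eq_iff lookup_add lookup_minus lookup_single when_def)
  thus ?thesis using assms that[of i m'] by (simp add: Var_def mult_single)
qed

lemma forms_1_eq_span: "(forms 1 :: ('n::finite,'k::field) mpoly set) = mp.span (range Var)"
proof
  show "mp.span (range Var) \<subseteq> (forms 1 :: ('n,'k) mpoly set)"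
    by (rule mp.span_minimal[OF _ subspace_forms]) auto
  have "monom m \<in> mp.span (range Var :: ('n,'k) mpoly set)" if "mdeg m = 1" for m
  proof -
    from that have "mdeg m = Suc 0" by simp
    then obtain i m' where "(monom m :: ('n,'k) mpoly) = Var i * monom m'" "mdeg m' = 0"
      by (rule monom_split)
    thus ?thesis by (auto simp: mdeg_eq_0_iff intro: mp.span_base)
  qed
  thus "(forms 1 :: ('n,'k) mpoly set) \<subseteq> mp.span (range Var)"
    unfolding forms_eq_span by (intro mp.span_minimal) auto
qed

text \<open>
  Every form of positive degree is a combination of products of a linear form with a form of one
  degree less, so containments can be tested on products with any spanning set of linear forms.
\<close>

lemma forms_Suc_subset:
  assumes B: "(forms 1 :: ('n::finite,'k::field) mpoly set) \<subseteq> mp.span B" and "mp.subspace V"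
    and V: "\<And>b g. b \<in> B \<Longrightarrow> g \<in> forms n \<Longrightarrow> b * g \<in> V"
  shows "forms (Suc n) \<subseteq> V"
proof -
  have *: "b * g \<in> V" if "b \<in> mp.span B" "g \<in> forms n" for b g :: "('n,'k) mpoly"
    using that(1)
  proof (induction rule: mp.span_induct_alt)
    case base
    show ?case using assms(2) by (simp add: mp.subspace_0)
  next
    case (step c x y)
    thus ?case using V that assms(2)
      by (auto simp: distrib_right intro!: mp.subspace_add mp.subspace_scale)
  qed
  have "monom m \<in> V" if "mdeg m = Suc n" for m
  proof -
    from that obtain i m' where "(monom m :: ('n,'k) mpoly) = Var i * monom m'" "mdeg m' = n"
      by (rule monom_split)
    moreover have "Var i \<in> mp.span B" using B by (simp add: subset_iff)
    ultimately show ?thesis using * by (simp add: forms_iff)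
  qed
  thus ?thesis unfolding forms_eq_span using assms(2) by (intro mp.span_minimal) auto
qed

section \<open>Directional derivatives\<close>

lift_definition pderiv_mp :: "'n \<Rightarrow> ('n, 'k::field) mpoly \<Rightarrow> ('n, 'k) mpoly" is
  "\<lambda>i f m. of_nat (Suc (Poly_Mapping.lookup m i)) * f (m + Poly_Mapping.single i 1)"
proof -
  fix i :: 'n and f :: "('n \<Rightarrow>\<^sub>0 nat) \<Rightarrow> 'k"
  assume "finite {m. f m \<noteq> 0}"
  hence "finite ((\<lambda>m. m + Poly_Mapping.single i 1) -` {m. f m \<noteq> 0})"
    by (rule finite_vimageI) (auto intro: injI)
  thus "finite {m. of_nat (Suc (Poly_Mapping.lookup m i)) * f (m + Poly_Mapping.single i 1) \<noteq> 0}"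
    by (rule rev_finite_subset) auto
qed

lemma pderiv_mp_add: "pderiv_mp i (f + g) = pderiv_mp i f + pderiv_mp i g"
  by (rule poly_mapping_eqI) (simp add: lookup_add pderiv_mp.rep_eq algebra_simps)

lemma pderiv_mp_smul: "pderiv_mp i (smul c f) = smul c (pderiv_mp i f)"
  by (rule poly_mapping_eqI) (simp add: pderiv_mp.rep_eq algebra_simps)

lemma pderiv_mp_monom:
  "pderiv_mp i (monom m) =
     smul (of_nat (Poly_Mapping.lookup m i)) (monom (m - Poly_Mapping.single i 1))"
proof (rule poly_mapping_eqI)
  fix k
  have "k + Poly_Mapping.single i 1 = m \<longleftrightarrow> Poly_Mapping.lookup m i \<noteq> 0 \<and> k = m - Poly_Mapping.single i 1"
    by (auto simp: poly_mapping_eq_iff fun_eq_iff lookup_add lookup_minus lookup_single when_def split: if_splits)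
  thus "Poly_Mapping.lookup (pderiv_mp i (monom m)) k =
      Poly_Mapping.lookup (smul (of_nat (Poly_Mapping.lookup m i)) (monom (m - Poly_Mapping.single i 1))) k"
    by (cases "Poly_Mapping.lookup m i = 0")
       (auto simp: pderiv_mp.rep_eq lookup_single when_def lookup_minus lookup_add)
qed

lemma pderiv_mp_mult: "pderiv_mp i (f * g) = pderiv_mp i f * g + f * pderiv_mp i g"
proof -
  have mm: "pderiv_mp i (monom m * monom m') =
      pderiv_mp i (monom m) * monom m' + (monom m :: ('a,'b) mpoly) * pderiv_mp i (monom m')" for m m'
  proof -
    let ?e = "Poly_Mapping.single i (1::nat)"
    have 1: "m - ?e + m' = m + m' - ?e" if "Poly_Mapping.lookup m i \<noteq> 0"
      using that by (auto simp: poly_mapping_eq_iff fun_eq_iff lookup_add lookup_minus lookup_single when_def)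
    have 2: "m + (m' - ?e) = m + m' - ?e" if "Poly_Mapping.lookup m' i \<noteq> 0"
      using that by (auto simp: poly_mapping_eq_iff fun_eq_iff lookup_add lookup_minus lookup_single when_def)
    show ?thesis
      using 1 2
      by (cases "Poly_Mapping.lookup m i = 0"; cases "Poly_Mapping.lookup m' i = 0")
         (simp_all add: pderiv_mp_monom mult_single lookup_add mp.scale_left_distrib)
  qed
  have z: "pderiv_mp i 0 = (0 :: ('a,'b) mpoly)"
    by (rule poly_mapping_eqI) (simp add: pderiv_mp.rep_eq)
  have m1: "pderiv_mp i (monom m * g) = pderiv_mp i (monom m) * g + monom m * pderiv_mp i g" for m
  proof -
    have "g \<in> mp.span (range monom)" by (simp add: span_monoms)
    thus ?thesis
      by (induction rule: mp.span_induct_alt)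
         (auto simp: z mm pderiv_mp_add pderiv_mp_smul distrib_left mp.scale_right_distrib)
  qed
  have "f \<in> mp.span (range monom)" by (simp add: span_monoms)
  thus ?thesis
    by (induction rule: mp.span_induct_alt)
       (auto simp: z m1 pderiv_mp_add pderiv_mp_smul distrib_right mp.scale_right_distrib)
qed

lemma pderiv_mp_forms: "f \<in> forms (Suc n) \<Longrightarrow> pderiv_mp i f \<in> forms n"
  unfolding forms_iff
proof
  fix m assume f: "\<forall>m\<in>Poly_Mapping.keys f. mdeg m = Suc n"
    and "m \<in> Poly_Mapping.keys (pderiv_mp i f)"
  hence "m + Poly_Mapping.single i 1 \<in> Poly_Mapping.keys f"
    by (auto simp: in_keys_iff pderiv_mp.rep_eq)
  with f have "mdeg (m + Poly_Mapping.single i 1) = Suc n" by blast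
  thus "mdeg m = n" by simp
qed

lemma pderiv_mp_Var: "pderiv_mp i (Var j :: ('n, 'k::field) mpoly) = (if i = j then 1 else 0)"
  unfolding Var_def pderiv_mp_monom by (auto simp: lookup_single)

text \<open>
  The derivation of the polynomial ring that takes the value \<open>d i\<close> at the \<open>i\<close>-th variable.
\<close>

definition dirderiv :: "('n::finite \<Rightarrow> 'k) \<Rightarrow> ('n, 'k::field) mpoly \<Rightarrow> ('n, 'k) mpoly" where
  "dirderiv d f = (\<Sum>i\<in>UNIV. smul (d i) (pderiv_mp i f))"

lemma dirderiv_add: "dirderiv d (f + g) = dirderiv d f + dirderiv d g"
  by (simp add: dirderiv_def pderiv_mp_add mp.scale_right_distrib sum.distrib)

lemma dirderiv_smul: "dirderiv d (smul c f) = smul c (dirderiv d f)"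
  by (simp add: dirderiv_def pderiv_mp_smul mp.scale_sum_right mult.commute)

lemma dirderiv_mult: "dirderiv d (f * g) = dirderiv d f * g + f * dirderiv d g"
  by (simp add: dirderiv_def pderiv_mp_mult mp.scale_right_distrib sum.distrib
      sum_distrib_left sum_distrib_right)

lemma dirderiv_forms: "f \<in> forms (Suc n) \<Longrightarrow> dirderiv d f \<in> forms n"
  unfolding dirderiv_def
  by (intro mp.subspace_sum subspace_forms mp.subspace_scale pderiv_mp_forms)

lemma dirderiv_linear_form: "dirderiv d (linear_form c) = smul (\<Sum>i\<in>UNIV. d i * c i) 1"
proof -
  have s: "pderiv_mp i (\<Sum>j\<in>A. smul (c j) (Var j)) = (\<Sum>j\<in>A. smul (c j) (pderiv_mp i (Var j)))"
    if "finite A" for i and A :: "'a set"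
    using that
  proof (induction A rule: finite_induct)
    case empty
    show ?case by (auto intro: poly_mapping_eqI simp: pderiv_mp.rep_eq)
  qed (simp add: pderiv_mp_add pderiv_mp_smul)
  have "pderiv_mp i (linear_form c) = smul (c i) 1" for i
    unfolding linear_form_eq
    by (simp add: s pderiv_mp_Var if_distrib[of "smul _"] cong: if_cong)
  thus ?thesis
    by (simp add: dirderiv_def mp.scale_sum_left)
qed

lemma dirderiv_0 [simp]: "dirderiv d 0 = 0"
  using dirderiv_smul[of d 0 0] by simp

lemma dirderiv_diff: "dirderiv d (f - g) = dirderiv d f - dirderiv d g"
  using dirderiv_add[of d "f - g" g] by (simp add: algebra_simps)

lemma dirderiv_1 [simp]: "dirderiv d 1 = 0"
  using dirderiv_mult[of d 1 1] by simp

lemma dirderiv_forms_0: "f \<in> forms 0 \<Longrightarrow> dirderiv d f = 0"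
  using forms_0[of f] by (auto simp: dirderiv_smul)

lemma dirderiv_power_const:
  assumes "dirderiv d u = smul \<delta> 1"
  shows "dirderiv d (u ^ Suc a) = smul (of_nat (Suc a) * \<delta>) (u ^ a)"
proof (induction a)
  case 0
  show ?case using assms by simp
next
  case (Suc a)
  have "dirderiv d (u ^ Suc (Suc a)) = dirderiv d u * u ^ Suc a + u * dirderiv d (u ^ Suc a)"
    by (simp add: dirderiv_mult)
  also have "\<dots> = smul \<delta> (u ^ Suc a) + smul (of_nat (Suc a) * \<delta>) (u ^ Suc a)"
    using Suc assms by simp
  finally show ?case by (simp add: algebra_simps flip: mp.scale_left_distrib)
qed

text \<open>
  Integration by parts. With \<open>v = u ^ Suc a * p\<close>, dividing the derivative of \<open>v\<close> by the nonzero number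
  \<open>of_nat (Suc a) * \<delta>\<close> produces the wanted term and an error \<open>u ^ Suc a * dirderiv d p\<close>, in which \<open>p\<close>
  has been replaced by a form of lower degree and the power of \<open>u\<close> has gone up; induction on the degree
  removes the error. Here characteristic zero enters. What matters later is that the primitive is still
  divisible by \<open>u ^ Suc a\<close>.
\<close>

lemma integrate:
  fixes u :: "('n::finite, 'k::field_char_0) mpoly"
  assumes u: "u \<in> forms 1" "dirderiv d u = smul \<delta> 1" "\<delta> \<noteq> 0"
  shows "p \<in> forms m \<Longrightarrow> \<exists>q\<in>forms m. dirderiv d (u ^ Suc a * q) = u ^ a * p"
proof (induction m arbitrary: p a)
  case 0
  define c where "c = 1 / (of_nat (Suc a) * \<delta>)"
  have "c * (of_nat (Suc a) * \<delta>) = 1" using u by (simp add: c_def del: of_nat_Suc)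
  hence "dirderiv d (u ^ Suc a * smul c p) = u ^ a * p"
    by (simp only: dirderiv_mult dirderiv_smul dirderiv_forms_0[OF 0] dirderiv_power_const[OF u(2)]) 
       (simp add: mult.commute del: of_nat_Suc)
  thus ?case using 0 subspace_forms by (blast intro: mp.subspace_scale)
next
  case (Suc m)
  define c where "c = 1 / (of_nat (Suc a) * \<delta>)"
  have c: "c * (of_nat (Suc a) * \<delta>) = 1" using u by (simp add: c_def del: of_nat_Suc)
  obtain q where q: "q \<in> forms m" "dirderiv d (u ^ Suc (Suc a) * q) = u ^ Suc a * dirderiv d p"
    using Suc.IH[OF dirderiv_forms[OF Suc.prems]] by blast
  have "u ^ Suc a * (p - u * q) = u ^ Suc a * p - u ^ Suc (Suc a) * q"
    by (simp add: algebra_simps)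
  hence "dirderiv d (u ^ Suc a * smul c (p - u * q)) =
      smul c (dirderiv d (u ^ Suc a * p) - dirderiv d (u ^ Suc (Suc a) * q))"
    by (simp only: smul_mult_right dirderiv_smul dirderiv_diff)
  also have "\<dots> = smul c (smul (of_nat (Suc a) * \<delta>) (u ^ a * p))"
    by (subst dirderiv_mult) (simp only: q dirderiv_power_const[OF u(2)], simp)
  also have "\<dots> = u ^ a * p" using c by (simp del: of_nat_Suc)
  finally have "dirderiv d (u ^ Suc a * smul c (p - u * q)) = u ^ a * p" .
  moreover have "smul c (p - u * q) \<in> forms (Suc m)"
    using Suc.prems forms_mult[OF u(1) q(1)]
    by (intro mp.subspace_scale mp.subspace_diff subspace_forms) simp_all
  ultimately show ?case by blast
qed

section \<open>Graded pieces of homogeneous ideals\<close>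

text \<open>
  The pair \<open>(g, d)\<close> stands for a generator \<open>g\<close> of degree \<open>d\<close>. The degree is carried along because
  multiples \<open>g * p\<close> enter only when \<open>p\<close> has degree exactly \<open>n - d\<close>; writing this as \<open>m + d = n\<close>
  excludes generators of degree above \<open>n\<close> without truncated subtraction.
\<close>

definition ideal_piece ::
  "(('n::finite, 'k::field) mpoly \<times> nat) set \<Rightarrow> nat \<Rightarrow> ('n, 'k) mpoly set" where
  "ideal_piece X n = mp.span {g * p |g d p m. (g, d) \<in> X \<and> p \<in> forms m \<and> m + d = n}"

lemma subspace_ideal_piece: "mp.subspace (ideal_piece X n)"
  by (simp add: ideal_piece_def)

lemma span_ideal_piece [simp]: "mp.span (ideal_piece X n) = ideal_piece X n"
  by (simp add: ideal_piece_def)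

lemma ideal_piece_base:
  "(g, d) \<in> X \<Longrightarrow> p \<in> forms m \<Longrightarrow> m + d = n \<Longrightarrow> g * p \<in> ideal_piece X n"
  unfolding ideal_piece_def by (rule mp.span_base) blast

lemma ideal_piece_mono: "X \<subseteq> Y \<Longrightarrow> ideal_piece X n \<subseteq> ideal_piece Y n"
  unfolding ideal_piece_def by (rule mp.span_mono) blast

lemma ideal_piece_minimal:
  assumes "mp.subspace V"
    and "\<And>g d p m. (g, d) \<in> X \<Longrightarrow> p \<in> forms m \<Longrightarrow> m + d = n \<Longrightarrow> g * p \<in> V"
  shows "ideal_piece X n \<subseteq> V"
  unfolding ideal_piece_def using assms by (intro mp.span_minimal) auto

lemma subspace_vimage_mult: 
  assumes "mp.subspace V" shows "mp.subspace {f. q * f \<in> V}"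
  using assms unfolding mp.subspace_def by (simp add: distrib_left)

lemma ideal_piece_mult:
  fixes f q :: "('n::finite, 'k::field) mpoly"
  assumes "f \<in> ideal_piece X n" "q \<in> forms m"
  shows "q * f \<in> ideal_piece X (n + m)"
proof -
  have "ideal_piece X n \<subseteq> {f. q * f \<in> ideal_piece X (n + m)}"
  proof (rule ideal_piece_minimal)
    fix g p :: "('n, 'k) mpoly" and d m' assume g: "(g, d) \<in> X" "p \<in> forms m'" "m' + d = n"
    have "g * (q * p) \<in> ideal_piece X (n + m)"
      by (rule ideal_piece_base[OF g(1) forms_mult[OF assms(2) g(2)]]) (use g in simp)
    thus "g * p \<in> {f. q * f \<in> ideal_piece X (n + m)}" by (simp add: mult.left_commute)
  qed (rule subspace_vimage_mult[OF subspace_ideal_piece])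
  thus ?thesis using assms by blast
qed

lemma ideal_piece_forms:
  assumes "\<And>g d. (g, d) \<in> X \<Longrightarrow> g \<in> forms d"
  shows "ideal_piece X n \<subseteq> forms n"
  by (rule ideal_piece_minimal[OF subspace_forms])
     (use assms forms_mult in \<open>fastforce simp: add.commute\<close>)

lemma ideal_piece_insert_linear:
  fixes h l :: "('n::finite, 'k::field) mpoly"
  assumes "h \<in> ideal_piece (insert (l, 1) X) (Suc n)"
  shows "\<exists>u\<in>ideal_piece X (Suc n). \<exists>f\<in>forms n. h = u + l * f"
proof -
  let ?V = "{u + l * f |u f. u \<in> ideal_piece X (Suc n) \<and> f \<in> forms n}"
  have zero: "0 \<in> ideal_piece X (Suc n)" "(0 :: ('n, 'k) mpoly) \<in> forms n"
    by (simp_all add: mp.subspace_0[OF subspace_forms] mp.subspace_0[OF subspace_ideal_piece])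
  have "ideal_piece (insert (l, 1) X) (Suc n) \<subseteq> ?V"
  proof (rule ideal_piece_minimal)
    show "mp.subspace ?V"
      unfolding mp.subspace_def
    proof (intro conjI ballI allI)
      have "0 = 0 + l * 0" by simp
      thus "0 \<in> ?V" using zero by blast
    next
      fix v w assume "v \<in> ?V" "w \<in> ?V"
      then obtain u f u' f' where *: "v = u + l * f" "w = u' + l * f'"
        "u \<in> ideal_piece X (Suc n)" "f \<in> forms n" "u' \<in> ideal_piece X (Suc n)" "f' \<in> forms n"
        by blast
      hence "v + w = (u + u') + l * (f + f')" by (simp add: algebra_simps)
      thus "v + w \<in> ?V"
        using * mp.subspace_add[OF subspace_forms] mp.subspace_add[OF subspace_ideal_piece] by blast
    next
      fix r v assume "v \<in> ?V"
      then obtain u f where *: "v = u + l * f" "u \<in> ideal_piece X (Suc n)" "f \<in> forms n" by blast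
      hence "smul r v = smul r u + l * smul r f" by (simp add: mp.scale_right_distrib)
      thus "smul r v \<in> ?V"
        using * mp.subspace_scale[OF subspace_forms] mp.subspace_scale[OF subspace_ideal_piece] by blast
    qed
  next
    fix g p :: "('n, 'k) mpoly" and d m
    assume g: "(g, d) \<in> insert (l, 1) X" and p: "p \<in> forms m" and m: "m + d = Suc n"
    show "g * p \<in> ?V"
    proof (cases "(g, d) \<in> X")
      case True
      have "g * p = g * p + l * 0" by simp
      thus ?thesis using ideal_piece_base[OF True p m] zero by blast
    next
      case False
      hence "g * p = 0 + l * p" "p \<in> forms n" using g p m by auto
      thus ?thesis using zero by blast
    qed
  qed
  thus ?thesis using assms by blast
qed

lemma subspace_dirderiv_image:
  assumes "mp.subspace V" shows "mp.subspace (dirderiv d ` V)"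
  unfolding mp.subspace_def
proof (intro conjI ballI allI)
  show "0 \<in> dirderiv d ` V"
    using mp.subspace_0[OF assms] by (intro image_eqI[of _ _ 0]) auto
next
  fix u v assume "u \<in> dirderiv d ` V" "v \<in> dirderiv d ` V"
  then obtain u' v' where "u' \<in> V" "v' \<in> V" "u = dirderiv d u'" "v = dirderiv d v'" by blast
  thus "u + v \<in> dirderiv d ` V"
    using mp.subspace_add[OF assms, of u' v'] by (metis dirderiv_add imageI)
next
  fix c u assume "u \<in> dirderiv d ` V"
  then obtain u' where "u' \<in> V" "u = dirderiv d u'" by blast
  thus "smul c u \<in> dirderiv d ` V"
    using mp.subspace_scale[OF assms, of u' c] by (metis dirderiv_smul imageI)
qed

section \<open>The kernel of an adapted derivation\<close>

text \<open>
  This plays the role of a change of variables to \<open>x, l, lam, y\<close>, with \<open>dirderiv d\<close> the partial derivative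
  in the direction of \<open>y\<close>. Only the values of the derivation and the span of these linear forms matter,
  so no substitution has to be carried out.
\<close>

locale adapted_derivation =
  fixes d :: "'n::finite \<Rightarrow> 'k::field_char_0" and x l lam y :: "('n, 'k) mpoly"
  assumes forms_1: "x \<in> forms 1" "l \<in> forms 1" "lam \<in> forms 1" "y \<in> forms 1"
    and D: "dirderiv d x = 0" "dirderiv d l = 0" "dirderiv d lam = 0" "dirderiv d y = 1"
    and spanning: "forms 1 \<subseteq> mp.span {x, l, lam, y}"
begin

abbreviation "kernel_span n \<equiv>
  mp.span ({lam ^ n} \<union> {x * lam ^ m |m. Suc m = n} \<union> ideal_piece {(x\<^sup>2, 2), (l, 1)} n)"

lemma power_in_forms: "lam ^ n \<in> forms n"
  using forms_power[OF forms_1(3), of n] by simp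

lemma kernel_span_mult:
  assumes "k \<in> kernel_span n" "b \<in> {x, l, lam}"
  shows "b * k \<in> kernel_span (Suc n)"
proof -
  let ?X = "{(x\<^sup>2, 2), (l, 1)}"
  have b: "b \<in> forms 1" using assms forms_1 by auto
  have xx: "x * (x * lam ^ m) \<in> ideal_piece ?X (Suc (Suc m))" for m
    using ideal_piece_base[of "x\<^sup>2" 2 ?X "lam ^ m" m] power_in_forms
    by (simp add: power2_eq_square mult.assoc)
  have ll: "l * f \<in> ideal_piece ?X (Suc m)" if "f \<in> forms m" for f m
    using ideal_piece_base[of l 1 ?X f m] that by simp
  have xl: "x * lam ^ m \<in> forms (Suc m)" for m
    using forms_mult[OF forms_1(1) power_in_forms[of m]] by simp
  have "kernel_span n \<subseteq> {k. b * k \<in> kernel_span (Suc n)}"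
  proof (rule mp.span_minimal[OF subsetI])
    fix k assume k: "k \<in> {lam ^ n} \<union> {x * lam ^ m |m. Suc m = n} \<union> ideal_piece ?X n"
    consider "k \<in> ideal_piece ?X n" | "k = lam ^ n" | m where "k = x * lam ^ m" "n = Suc m"
      using k by auto
    hence "b * k \<in> {lam ^ Suc n} \<union> {x * lam ^ m |m. Suc m = Suc n} \<union> ideal_piece ?X (Suc n)"
    proof cases
      case 1
      thus ?thesis using ideal_piece_mult[OF _ b, of k ?X n] by simp
    next
      case 2
      thus ?thesis using assms(2) ll power_in_forms by auto
    next
      case 3
      have "lam * (x * lam ^ m) = x * lam ^ n" using 3 by (simp add: mult.left_commute)
      thus ?thesis using assms(2) ll xl xx 3 by auto
    qed
    thus "k \<in> {k. b * k \<in> kernel_span (Suc n)}"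
      by (simp only: mem_Collect_eq mp.span_base)
  qed (rule subspace_vimage_mult[OF mp.subspace_span])
  thus ?thesis using assms by blast
qed

text \<open>
  One step of the expansion in powers of \<open>y\<close>: any form is a form not involving \<open>y\<close> plus a multiple
  of \<open>y\<close>. Modulo \<open>x\<^sup>2\<close> and \<open>l\<close>, forms of degree \<open>n\<close> not involving \<open>y\<close> are spanned by \<open>lam ^ n\<close> and
  \<open>x * lam ^ (n - 1)\<close>.
\<close>

lemma kernel_decomp:
  "forms n \<subseteq> {k + y * g |k g. k \<in> kernel_span n \<and> dirderiv d k = 0 \<and>
                g \<in> (if n = 0 then {0} else forms (n - 1))}"
proof (induction n)
  case 0
  have "f \<in> kernel_span 0" if f: "f \<in> forms 0" for f
  proof -
    obtain c where "f = smul c 1" using forms_0[OF f] by blast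
    moreover have "1 \<in> kernel_span 0" by (rule mp.span_base) simp
    ultimately show ?thesis by (simp add: mp.span_scale)
  qed
  thus ?case using dirderiv_forms_0 by fastforce
next
  case (Suc n)
  let ?V = "{k + y * g |k g. k \<in> kernel_span (Suc n) \<and> dirderiv d k = 0 \<and> g \<in> forms n}"
  have V: "mp.subspace ?V"
    unfolding mp.subspace_def
  proof (intro conjI ballI allI)
    have "0 = 0 + y * 0" "0 \<in> kernel_span (Suc n)" "dirderiv d 0 = 0" "0 \<in> forms n"
      by (simp_all add: mp.span_zero mp.subspace_0[OF subspace_forms])
    thus "0 \<in> ?V" by blast
  next
    fix a b assume "a \<in> ?V" "b \<in> ?V"
    then obtain k g k' g' where *: "a = k + y * g" "b = k' + y * g'"
      "k \<in> kernel_span (Suc n)" "dirderiv d k = 0" "g \<in> forms n"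
      "k' \<in> kernel_span (Suc n)" "dirderiv d k' = 0" "g' \<in> forms n" by auto
    have "a + b = (k + k') + y * (g + g')" using * by (simp add: algebra_simps)
    moreover have "k + k' \<in> kernel_span (Suc n)" "dirderiv d (k + k') = 0" "g + g' \<in> forms n"
      using * by (auto simp: dirderiv_add intro: mp.span_add mp.subspace_add subspace_forms)
    ultimately show "a + b \<in> ?V" by blast
  next
    fix c a assume "a \<in> ?V"
    then obtain k g where *: "a = k + y * g"
      "k \<in> kernel_span (Suc n)" "dirderiv d k = 0" "g \<in> forms n" by auto
    have "smul c a = smul c k + y * smul c g" using * by (simp add: mp.scale_right_distrib)
    moreover have "smul c k \<in> kernel_span (Suc n)" "dirderiv d (smul c k) = 0" "smul c g \<in> forms n"
      using * by (auto simp: dirderiv_smul intro: mp.span_scale mp.subspace_scale subspace_forms)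
    ultimately show "smul c a \<in> ?V" by blast
  qed
  have "forms (Suc n) \<subseteq> ?V"
  proof (rule forms_Suc_subset[OF spanning V])
    fix b f :: "('n, 'k) mpoly" assume b: "b \<in> {x, l, lam, y}" and f: "f \<in> forms n"
    show "b * f \<in> ?V"
    proof (cases "b = y")
      case True
      have "0 \<in> kernel_span (Suc n)" "dirderiv d 0 = 0" "b * f = 0 + y * f"
        using True by (simp_all add: mp.span_zero)
      thus ?thesis using f by blast
    next
      case False
      hence b: "b \<in> {x, l, lam}" "dirderiv d b = 0" "b \<in> forms 1" using b D forms_1 by auto
      from f Suc obtain k g where *: "f = k + y * g" "k \<in> kernel_span n" "dirderiv d k = 0"
        "g \<in> (if n = 0 then {0} else forms (n - 1))" by blast
      have "b * g \<in> forms n"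
      proof (cases n)
        case 0
        thus ?thesis using * mp.subspace_0[OF subspace_forms] by simp
      next
        case (Suc m)
        thus ?thesis using * forms_mult[OF b(3), of g m] by simp
      qed
      moreover have "b * f = b * k + y * (b * g)" using * by (simp add: algebra_simps)
      moreover have "dirderiv d (b * k) = 0" using * b by (simp add: dirderiv_mult)
      moreover have "b * k \<in> kernel_span (Suc n)" using kernel_span_mult * b by blast
      ultimately show ?thesis by blast
    qed
  qed
  thus ?case by simp
qed

text \<open>
  In adapted coordinates \<open>y * dirderiv d g\<close> multiplies the part of \<open>g\<close> of degree \<open>e\<close> in \<open>y\<close> by \<open>e\<close>, so the
  operator on the left multiplies it by the nonzero number \<open>e + a + 1\<close>. The proof avoids the expansion:
  differentiating the equation gives the same equation for \<open>dirderiv d g\<close>.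
\<close>

lemma euler_inj:
  assumes "g \<in> forms n" "smul (of_nat (Suc a)) g + y * dirderiv d g = 0"
  shows "g = 0"
  using assms
proof (induction n arbitrary: a g)
  case 0
  thus ?case using dirderiv_forms_0[OF 0(1)] by (auto simp del: of_nat_Suc)
next
  case (Suc n)
  have "dirderiv d (smul (of_nat (Suc a)) g + y * dirderiv d g) = 0"
    using Suc.prems by simp
  hence "smul (of_nat (Suc a)) (dirderiv d g) + (dirderiv d g + y * dirderiv d (dirderiv d g)) = 0"
    by (simp add: dirderiv_add dirderiv_smul dirderiv_mult D del: of_nat_Suc)
  hence "smul (of_nat (Suc (Suc a))) (dirderiv d g) + y * dirderiv d (dirderiv d g) = 0"
    unfolding of_nat_Suc[of "Suc a"] mp.scale_left_distrib by (simp add: ac_simps del: of_nat_Suc)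
  hence "dirderiv d g = 0"
    using Suc.IH[OF dirderiv_forms[OF Suc.prems(1)]] by blast
  thus ?case using Suc.prems(2) by (auto simp del: of_nat_Suc)
qed

text \<open>
  If the derivative of \<open>k + y * g\<close> vanishes and that of \<open>k\<close> does too, then \<open>g + y * dirderiv d g = 0\<close>,
  hence \<open>g = 0\<close>.
\<close>

lemma kernel_subset:
  assumes "f \<in> forms n" "dirderiv d f = 0"
  shows "f \<in> kernel_span n"
proof -
  obtain k g where *: "f = k + y * g" "k \<in> kernel_span n" "dirderiv d k = 0"
    "g \<in> (if n = 0 then {0} else forms (n - 1))"
    using kernel_decomp assms by blast
  have "g + y * dirderiv d g = 0"
    using assms(2) * D by (simp add: dirderiv_add dirderiv_mult)
  hence "g = 0" using *(4) euler_inj[of g "n - 1" 0] by (auto split: if_splits)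
  thus ?thesis using * by simp
qed

text \<open>
  The derivation maps forms of degree \<open>Suc n\<close> onto forms of degree \<open>n\<close>, with kernel controlled by
  \<open>kernel_subset\<close>. If it also maps the ideal generated by \<open>X\<close> onto at least the ideal generated by \<open>X'\<close>,
  then a spanning set of the quotient by \<open>X'\<close> in degree \<open>n\<close> lifts to one of the quotient by \<open>X\<close> in degree
  \<open>Suc n\<close>, up to the two kernel elements.
\<close>

lemma lift_generators:
  assumes X: "{(x\<^sup>2, 2), (l, 1)} \<subseteq> X" "\<And>g e. (g, e) \<in> X \<Longrightarrow> g \<in> forms e"
    and lift: "\<And>g. g \<in> ideal_piece X' n \<Longrightarrow> \<exists>h\<in>ideal_piece X (Suc n). dirderiv d h = g"
    and G': "finite G'" "G' \<subseteq> forms n" "forms n \<subseteq> mp.span (G' \<union> ideal_piece X' n)"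
  shows "\<exists>G. finite G \<and> card G \<le> card G' \<and> G \<subseteq> forms (Suc n) \<and>
    forms (Suc n) \<subseteq> mp.span (G \<union> {lam ^ Suc n, x * lam ^ n} \<union> ideal_piece X (Suc n))"
proof -
  have "\<exists>h\<in>forms (Suc n). dirderiv d h = g" if g: "g \<in> forms n" for g
  proof -
    obtain q where q: "q \<in> forms n" "dirderiv d (y ^ Suc 0 * q) = y ^ 0 * g"
      using integrate[OF forms_1(4), of d 1 g n 0] D g by auto
    thus ?thesis using forms_mult[OF forms_1(4) q(1)] by (intro bexI[of _ "y * q"]) simp_all
  qed
  then obtain F where F: "\<And>g. g \<in> forms n \<Longrightarrow> F g \<in> forms (Suc n)"
    "\<And>g. g \<in> forms n \<Longrightarrow> dirderiv d (F g) = g"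
    by metis
  let ?G = "F ` G'"
  let ?S = "?G \<union> ideal_piece X (Suc n)"
  have prim: "\<exists>h\<in>mp.span ?S. dirderiv d h = w" if "w \<in> mp.span (G' \<union> ideal_piece X' n)" for w
    using that
  proof (induction rule: mp.span_induct_alt)
    case base
    show ?case by (auto intro!: bexI[of _ 0] mp.span_zero)
  next
    case (step c v w)
    obtain h where h: "h \<in> mp.span ?S" "dirderiv d h = w" using step by blast
    have "\<exists>k\<in>mp.span ?S. dirderiv d k = v"
    proof (cases "v \<in> G'")
      case True
      thus ?thesis using F G' by (intro bexI[of _ "F v"]) (auto intro: mp.span_base)
    next
      case False
      thus ?thesis using step(1) lift[of v] by (auto intro: mp.span_base)
    qed
    then obtain k where "k \<in> mp.span ?S" "dirderiv d k = v" by blast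
    with h show ?case
      by (intro bexI[of _ "smul c k + h"])
         (auto simp: dirderiv_add dirderiv_smul intro: mp.span_add mp.span_scale)
  qed
  have S: "mp.span ?S \<subseteq> forms (Suc n)"
    using F G' ideal_piece_forms[OF X(2)] by (intro mp.span_minimal subspace_forms) auto
  let ?T = "?G \<union> {lam ^ Suc n, x * lam ^ n} \<union> ideal_piece X (Suc n)"
  have "f \<in> mp.span ?T" if f: "f \<in> forms (Suc n)" for f
  proof -
    obtain h where h: "h \<in> mp.span ?S" "dirderiv d h = dirderiv d f"
      using prim dirderiv_forms[OF f] G' by blast
    have "f - h \<in> forms (Suc n)" using f h S by (intro mp.subspace_diff subspace_forms) auto
    hence "f - h \<in> kernel_span (Suc n)"
      using h by (intro kernel_subset) (simp_all add: dirderiv_diff)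
    also have "\<dots> \<subseteq> mp.span ?T"
      using ideal_piece_mono[OF X(1)] by (intro mp.span_mono) auto
    finally have "f - h \<in> mp.span ?T" .
    moreover have "h \<in> mp.span ?T" using h mp.span_mono[of ?S ?T] by auto
    ultimately show ?thesis using mp.span_add by fastforce
  qed
  moreover have "finite ?G" "card ?G \<le> card G'" "?G \<subseteq> forms (Suc n)"
    using F G' by (auto simp: card_image_le)
  ultimately show ?thesis by (intro exI[of _ ?G]) blast
qed

end

section \<open>The codimension of an ideal of powers modulo a general linear form\<close>

text \<open>
  The linear forms \<open>x\<close> and \<open>lam k\<close> are in general position modulo \<open>l\<close>, phrased in the two ways in which
  this is used: for each \<open>i\<close> there is a derivation that kills \<open>x\<close>, \<open>l\<close>, \<open>lam i\<close> and no other \<open>lam k\<close>,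
  and any three of the \<open>lam k\<close> together with \<open>l\<close> span the linear forms.
\<close>

locale general_forms =
  fixes x l :: "('n::finite, 'k::field_char_0) mpoly" and lam :: "'i \<Rightarrow> ('n, 'k) mpoly"
    and K :: "'i set"
  assumes K: "finite K" "K \<noteq> {}" "card K \<le> 4"
    and lam_forms: "\<And>k. k \<in> K \<Longrightarrow> lam k \<in> forms 1"
    and derivation: "\<And>i. i \<in> K \<Longrightarrow> \<exists>d y. adapted_derivation d x l (lam i) y \<and>
        (\<forall>k\<in>K - {i}. \<exists>\<delta>. \<delta> \<noteq> 0 \<and> dirderiv d (lam k) = smul \<delta> 1)"
    and triples: "\<And>T. T \<subseteq> K \<Longrightarrow> card T = 3 \<Longrightarrow> forms 1 \<subseteq> mp.span (insert l (lam ` T))"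
begin

lemma xl_forms: "x \<in> forms 1" "l \<in> forms 1"
  using K derivation by (auto simp: adapted_derivation_def ex_in_conv[symmetric])

abbreviation powers :: "('i \<Rightarrow> nat) \<Rightarrow> (('n, 'k) mpoly \<times> nat) set" where
  "powers a \<equiv> insert (x\<^sup>2, 2) ((\<lambda>k. (lam k ^ a k, a k)) ` K)"

abbreviation powers_l :: "('i \<Rightarrow> nat) \<Rightarrow> (('n, 'k) mpoly \<times> nat) set" where
  "powers_l a \<equiv> insert (l, 1) (powers a)"

text \<open>
  Modulo \<open>l\<close> and \<open>x\<^sup>2\<close> the polynomial ring in four variables has dimension \<open>2 * n + 1\<close> in degree \<open>n\<close>,
  and the multiples of \<open>lam k ^ a k\<close> form a space of dimension at most \<open>2 * (n - a k) + 1\<close>. The expected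
  codimension is what remains if no relations occur between these spaces. It may be negative.
\<close>

definition expected :: "('i \<Rightarrow> nat) \<Rightarrow> nat \<Rightarrow> int" where
  "expected a n = 2 * int n + 1 - (\<Sum>k\<in>K. if a k \<le> n then 2 * (int n - int (a k)) + 1 else 0)"

lemma powers_l_forms: "(g, d) \<in> powers_l a \<Longrightarrow> g \<in> forms d"
  using xl_forms forms_power[of x 1 2] forms_power[OF lam_forms] by auto

lemma expected_step:
  assumes "i \<in> K" "\<And>k. k \<in> K \<Longrightarrow> a k > 0"
  shows "expected a (Suc n) = expected (\<lambda>k. if k = i then a k else a k - 1) n +
    (if a i \<le> n then 0 else if a i = Suc n then 1 else 2)"
proof -
  define t :: "nat \<Rightarrow> nat \<Rightarrow> int" where "t b n = (if b \<le> n then 2 * (int n - int b) + 1 else 0)" for b n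
  have *: "t (a k) (Suc n) = t (a k - 1) n" if "k \<in> K" for k
    using assms(2)[OF that] by (auto simp: t_def)
  have "(\<Sum>k\<in>K. t (a k) (Suc n)) = t (a i) (Suc n) + (\<Sum>k\<in>K-{i}. t (a k) (Suc n))"
    using assms K by (simp add: sum.remove)
  also have "(\<Sum>k\<in>K-{i}. t (a k) (Suc n)) = (\<Sum>k\<in>K-{i}. t (if k = i then a k else a k - 1) n)"
    by (rule sum.cong) (auto simp: *)
  finally have "(\<Sum>k\<in>K. t (a k) (Suc n)) =
      (\<Sum>k\<in>K. t (if k = i then a k else a k - 1) n) + (t (a i) (Suc n) - t (a i) n)"
    using assms K by (simp add: sum.remove[of K i])
  thus ?thesis unfolding expected_def t_def[symmetric] by (simp add: t_def)
qed

text \<open>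
  The heart of the proof, by induction on the degree. For a derivation that kills \<open>x\<close>, \<open>l\<close> and \<open>lam i\<close>
  but no other \<open>lam k\<close>, integration by parts shows that the ideal with exponents \<open>a\<close> in degree \<open>Suc n\<close> is mapped onto at
  least the ideal in degree \<open>n\<close> in which every exponent except \<open>a i\<close> has been lowered by one. The kernel
  contributes \<open>0\<close>, \<open>1\<close> or \<open>2\<close> further generators, according as \<open>a i \<le> n\<close>, \<open>a i = Suc n\<close> or
  \<open>a i > Suc n\<close>, and by \<open>expected_step\<close> this is exactly how the expected codimension changes.

  Geometrically, for four variables, the dual of this ideal is a linear system of plane curves of degree
  \<open>n\<close> with a point of multiplicity \<open>n - 1\<close> and further points of multiplicity \<open>n + 1 - a k\<close>, and the
  derivation is dual to removing the line through the first point and the \<open>i\<close>-th one from the system.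
\<close>

theorem expected_codim:
  "forms n \<subseteq> ideal_piece (powers_l a) n \<or>
   (\<exists>G. finite G \<and> int (card G) \<le> expected a n \<and> G \<subseteq> forms n \<and>
        forms n \<subseteq> mp.span (G \<union> ideal_piece (powers_l a) n))"
proof (induction n arbitrary: a)
  case (0 a)
  show ?case
  proof (cases "\<exists>k\<in>K. a k = 0")
    case True
    hence "(1, 0) \<in> powers_l a" by force
    hence "f \<in> ideal_piece (powers_l a) 0" if "f \<in> forms 0" for f
      using ideal_piece_base[of 1 0 _ f 0 0] that by simp
    thus ?thesis by blast
  next
    case False
    have "forms 0 \<subseteq> mp.span {1}"
      using forms_0 by (force simp: mp.span_singleton)
    also have "\<dots> \<subseteq> mp.span ({1} \<union> ideal_piece (powers_l a) 0)"
      by (rule mp.span_mono) blast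
    finally have "forms 0 \<subseteq> mp.span ({1} \<union> ideal_piece (powers_l a) 0)" .
    moreover have "expected a 0 = 1"
      unfolding expected_def using False by (subst sum.neutral) auto
    ultimately show ?thesis
      by (intro disjI2 exI[of _ "{1}"]) auto
  qed
next
  case (Suc n a)
  let ?J = "ideal_piece (powers_l a) (Suc n)"
  show ?case
  proof (cases "\<exists>k\<in>K. a k = 0")
    case True
    hence "(1, 0) \<in> powers_l a" by force
    hence "f \<in> ?J" if "f \<in> forms (Suc n)" for f
      using ideal_piece_base[of 1 0 _ f "Suc n" "Suc n"] that by simp
    thus ?thesis by blast
  next
    case False
    hence pos: "\<And>k. k \<in> K \<Longrightarrow> a k > 0" by auto
    \<comment> \<open>The least exponent is used: once it exceeds \<open>n\<close>, so do all the others, and then the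
      expected codimension is large enough, except for one case in degree one, to absorb the
      kernel elements even when the quotient in degree \<open>n\<close> vanishes.\<close>
    obtain i where i: "i \<in> K" "\<And>k. k \<in> K \<Longrightarrow> a i \<le> a k"
      using arg_min_if_finite(1)[OF K(1,2)] arg_min_least[OF K(1,2)] by blast
    define a' where "a' = (\<lambda>k. if k = i then a k else a k - 1)"
    from derivation[OF i(1)] obtain d y where dy: "adapted_derivation d x l (lam i) y"
      and \<delta>: "\<forall>k\<in>K - {i}. \<exists>\<delta>. \<delta> \<noteq> 0 \<and> dirderiv d (lam k) = smul \<delta> 1"
      by (elim exE conjE)
    interpret adapted_derivation d x l "lam i" y by (rule dy)
    have lift: "\<exists>h\<in>?J. dirderiv d h = g" if "g \<in> ideal_piece (powers_l a') n" for g
    proof -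
      have "ideal_piece (powers_l a') n \<subseteq> dirderiv d ` ?J"
      proof (rule ideal_piece_minimal)
        show "mp.subspace (dirderiv d ` ?J)"
          by (rule subspace_dirderiv_image[OF subspace_ideal_piece])
      next
        fix g p :: "('n, 'k) mpoly" and e m
        assume g: "(g, e) \<in> powers_l a'" and p: "p \<in> forms m" and m: "m + e = n"
        have const: "g * p \<in> dirderiv d ` ?J"
          if "dirderiv d g = 0" "(g, e) \<in> powers_l a"
        proof -
          obtain q where q: "q \<in> forms m" "dirderiv d (y ^ Suc 0 * q) = y ^ 0 * p"
            using integrate[OF forms_1(4), of d 1 p m 0] D p by auto
          have yq: "y * q \<in> forms (Suc m)" using forms_mult[OF forms_1(4) q(1)] by simp
          have "g * (y * q) \<in> ?J" using ideal_piece_base[OF that(2) yq] m by simp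
          moreover have "dirderiv d (g * (y * q)) = g * p"
            using q that by (simp add: dirderiv_mult[of d g])
          ultimately show ?thesis by (rule image_eqI[OF sym, rotated])
        qed
        from g consider "g = x\<^sup>2" "e = 2" | "g = l" "e = 1" | "g = lam i ^ a i" "e = a i"
          | k where "k \<in> K - {i}" "g = lam k ^ (a k - 1)" "e = a k - 1"
          by (auto simp: a'_def split: if_splits)
        thus "g * p \<in> dirderiv d ` ?J"
        proof cases
          case 1
          thus ?thesis using D by (intro const) (simp_all add: power2_eq_square dirderiv_mult)
        next
          case 2
          thus ?thesis using D by (intro const) simp_all
        next
          case 3
          have "dirderiv d (lam i ^ b) = 0" for b
            by (induction b) (simp_all add: dirderiv_mult D)
          thus ?thesis using 3 i by (intro const) simp_all
        next
          case 4
          then obtain \<delta> where "\<delta> \<noteq> 0" "dirderiv d (lam k) = smul \<delta> 1" using \<delta> by blast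
          then obtain q where q: "q \<in> forms m"
            "dirderiv d (lam k ^ Suc (a k - 1) * q) = lam k ^ (a k - 1) * p"
            using integrate[OF lam_forms _ _ p, of k] 4 by blast
          have "Suc (a k - 1) = a k" using 4 pos by simp
          hence "dirderiv d (lam k ^ a k * q) = g * p" using q 4 by simp
          moreover have "lam k ^ a k * q \<in> ?J"
            using ideal_piece_base[of "lam k ^ a k" "a k" "powers_l a" q m "Suc n"] q 4 m pos[of k]
            by auto
          ultimately show ?thesis by (rule image_eqI[OF sym])
        qed
      qed
      thus ?thesis using that by blast
    qed
    obtain G0 where G0: "finite G0" "G0 \<subseteq> forms n" "forms n \<subseteq> mp.span (G0 \<union> ideal_piece (powers_l a') n)"
      "G0 = {} \<or> int (card G0) \<le> expected a' n"
    proof -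
      consider "forms n \<subseteq> ideal_piece (powers_l a') n" |
        G where "finite G" "int (card G) \<le> expected a' n" "G \<subseteq> forms n"
        "forms n \<subseteq> mp.span (G \<union> ideal_piece (powers_l a') n)"
        using Suc.IH[of a'] by blast
      thus ?thesis
      proof cases
        case 1
        thus ?thesis
          using that[of "{}"] by simp
      qed (use that in blast)
    qed
    have "\<exists>G1. finite G1 \<and> card G1 \<le> card G0 \<and> G1 \<subseteq> forms (Suc n) \<and>
      forms (Suc n) \<subseteq> mp.span (G1 \<union> {lam i ^ Suc n, x * lam i ^ n} \<union> ?J)"
    proof (rule lift_generators[OF _ _ _ G0(1,2,3)])
      show "g \<in> forms e" if "(g, e) \<in> powers_l a" for g e by (rule powers_l_forms[OF that])
      show "\<exists>h\<in>?J. dirderiv d h = g" if "g \<in> ideal_piece (powers_l a') n" for g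
        by (rule lift[OF that])
    qed auto
    then obtain G1 where G1: "finite G1" "card G1 \<le> card G0" "G1 \<subseteq> forms (Suc n)"
      "forms (Suc n) \<subseteq> mp.span (G1 \<union> {lam i ^ Suc n, x * lam i ^ n} \<union> ?J)"
      by (elim exE conjE)
    have step: "expected a (Suc n) = expected a' n + (if a i \<le> n then 0 else if a i = Suc n then 1 else 2)"
      unfolding a'_def by (rule expected_step[OF i(1) pos])
    have x_pow: "x * lam i ^ m \<in> forms (Suc m)" for m
      using forms_mult[OF forms_1(1) power_in_forms[of m]] by simp
    have lam_in_J: "lam i ^ Suc n \<in> ?J" if "a i \<le> Suc n"
    proof -
      have "lam i ^ a i * lam i ^ (Suc n - a i) \<in> ?J"
        by (rule ideal_piece_base[OF _ power_in_forms]) (use that i in auto)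
      thus ?thesis using that by (simp flip: power_add)
    qed
    consider "a i \<le> n" | "a i = Suc n" | "a i > Suc n" by linarith
    thus ?thesis
    proof cases
      case 1
      have "lam i ^ a i * (x * lam i ^ (n - a i)) \<in> ?J"
        by (rule ideal_piece_base[OF _ x_pow]) (use 1 i in auto)
      hence "x * lam i ^ n \<in> ?J" using 1 by (simp add: mult.left_commute flip: power_add)
      hence "G1 \<union> {lam i ^ Suc n, x * lam i ^ n} \<union> ?J = G1 \<union> ?J"
        using lam_in_J 1 by auto
      hence sp: "forms (Suc n) \<subseteq> mp.span (G1 \<union> ?J)" using G1 by simp
      show ?thesis
      proof (cases "G0 = {}")
        case True
        hence "G1 = {}" using G1 by simp
        thus ?thesis using sp by simp
      next
        case False
        thus ?thesis using G0 G1 sp step 1 by (intro disjI2 exI[of _ G1]) auto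
      qed
    next
      case 2
      let ?G = "insert (x * lam i ^ n) G1"
      have "G1 \<union> {lam i ^ Suc n, x * lam i ^ n} \<union> ?J = ?G \<union> ?J"
        using lam_in_J 2 by auto
      hence sp: "forms (Suc n) \<subseteq> mp.span (?G \<union> ?J)" using G1 by simp
      have card: "card ?G \<le> card G0 + 1"
        using G1 by (simp add: card_insert_if)
      have G: "finite ?G" "?G \<subseteq> forms (Suc n)" using G1 x_pow by auto
      define T where "T = {k\<in>K. a k = Suc n}"
      have exp: "expected a (Suc n) = 2 * int n + 3 - int (card T)"
      proof -
        have "(\<Sum>k\<in>K. if a k \<le> Suc n then 2 * (int (Suc n) - int (a k)) + 1 else 0) =
            (\<Sum>k\<in>K. if a k = Suc n then 1 else 0)"
          by (rule sum.cong) (use i(2) 2 in force)+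
        also have "\<dots> = int (card T)" using K by (simp add: T_def sum.If_cases Int_def)
        finally show ?thesis by (simp add: expected_def)
      qed
      \<comment> \<open>The expected codimension \<open>2 * n + 3 - card T\<close> can fail to be positive only in degree one,
        and there three of the linear forms together with \<open>l\<close> span everything.\<close>
      have "card T \<le> 4" using card_mono[of K T] K by (auto simp: T_def)
      show ?thesis
      proof (cases "n = 0 \<and> card T \<ge> 3")
        case True
        then obtain T' where T': "T' \<subseteq> T" "card T' = 3"
          by (meson obtain_subset_with_card_n)
        have "insert l (lam ` T') \<subseteq> ?J"
        proof
          fix v assume v: "v \<in> insert l (lam ` T')"
          hence "(v, 1) \<in> powers_l a" using T' True by (force simp: T_def)
          thus "v \<in> ?J" using ideal_piece_base[of v 1 _ 1 0 "Suc n"] True by simp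
        qed
        hence "mp.span (insert l (lam ` T')) \<subseteq> ?J"
          by (rule mp.span_minimal[OF _ subspace_ideal_piece])
        moreover have "T' \<subseteq> K" using T' by (auto simp: T_def)
        ultimately show ?thesis using triples[of T'] T' True by auto
      next
        case False
        hence "expected a (Suc n) \<ge> 1" using exp \<open>card T \<le> 4\<close> by linarith
        hence "int (card ?G) \<le> expected a (Suc n)"
          using card G0(4) step 2 by auto
        thus ?thesis using sp G by blast
      qed
    next
      case 3
      let ?G = "{lam i ^ Suc n, x * lam i ^ n} \<union> G1"
      have "card ?G \<le> card {lam i ^ Suc n, x * lam i ^ n} + card G1" by (rule card_Un_le)
      hence card: "card ?G \<le> card G0 + 2" using G1(2) card_insert_le_m1[of 2 "{x * lam i ^ n}"] 
        by (simp add: card_insert_if split: if_splits)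
      have G: "finite ?G" "?G \<subseteq> forms (Suc n)" using G1 x_pow power_in_forms[of "Suc n"] by auto
      have sp: "forms (Suc n) \<subseteq> mp.span (?G \<union> ?J)" using G1 by (simp add: Un_commute)
      have "(\<Sum>k\<in>K. if a k \<le> Suc n then 2 * (int (Suc n) - int (a k)) + 1 else 0) = 0"
        by (rule sum.neutral) (use i(2) 3 in force)
      hence "expected a (Suc n) = 2 * int n + 3" by (simp add: expected_def)
      hence "int (card ?G) \<le> expected a (Suc n)"
        using card G0(4) step 3 by auto
      thus ?thesis using sp G by blast
    qed
  qed
qed

end

section \<open>From codimensions to maximal rank\<close>

lemma span_exchange:
  assumes "finite B" "f \<in> mp.span (B \<union> I)" "f \<notin> mp.span I"
  shows "\<exists>b\<in>B. b \<in> mp.span (insert f ((B - {b}) \<union> I))"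
  using assms
proof (induction B rule: finite_induct)
  case (insert b B)
  show ?case
  proof (cases "f \<in> mp.span (B \<union> I)")
    case True
    then obtain b' where b': "b' \<in> B" "b' \<in> mp.span (insert f ((B - {b'}) \<union> I))"
      using insert by blast
    have "mp.span (insert f ((B - {b'}) \<union> I)) \<subseteq> mp.span (insert f ((insert b B - {b'}) \<union> I))"
      by (rule mp.span_mono) blast
    thus ?thesis using b' by blast
  next
    case False
    have "b \<in> mp.span (insert f (B \<union> I))"
      by (rule mp.in_span_insert[OF _ False]) (use insert in simp)
    moreover have "insert b B - {b} = B" using insert by blast
    ultimately show ?thesis by (intro bexI[of _ b]) simp_all
  qed
qed simp

lemma mult_span_subset:
  assumes "mp.subspace V" "\<And>f. f \<in> S \<Longrightarrow> g * f \<in> V" "f \<in> mp.span S"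
  shows "g * f \<in> V"
proof -
  have "mp.span S \<subseteq> {f. g * f \<in> V}"
    using assms by (intro mp.span_minimal subspace_vimage_mult) auto
  thus ?thesis using assms by blast
qed

context general_forms
begin

lemma codim_0_mono:
  assumes "forms s \<subseteq> ideal_piece (powers_l a) s" "s \<le> n"
  shows "forms n \<subseteq> ideal_piece (powers_l a) n"
  using assms(2)
proof (induction n rule: dec_induct)
  case base
  show ?case by (rule assms)
next
  case (step n)
  show ?case
  proof (rule forms_Suc_subset[OF _ subspace_ideal_piece])
    show "forms 1 \<subseteq> mp.span (range Var)" by (simp add: forms_1_eq_span[simplified])
  next
    fix b g :: "('n, 'k) mpoly" assume "b \<in> range Var" "g \<in> forms n"
    thus "b * g \<in> ideal_piece (powers_l a) (Suc n)"
      using ideal_piece_mult[of g "powers_l a" n b 1] step by auto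
  qed
qed

lemma ideal_piece_l_0: "ideal_piece (powers_l a) 0 \<subseteq> ideal_piece (powers a) 0"
  by (rule ideal_piece_minimal[OF subspace_ideal_piece]) (auto intro: ideal_piece_base)

lemma generate_next:
  assumes C: "forms s \<subseteq> mp.span (C \<union> ideal_piece (powers a) s)"
    and G: "forms (Suc s) \<subseteq> mp.span (G \<union> ideal_piece (powers_l a) (Suc s))"
  shows "forms (Suc s) \<subseteq> mp.span (G \<union> (*) l ` C \<union> ideal_piece (powers a) (Suc s))"
    (is "_ \<subseteq> mp.span ?S")
proof -
  have l: "l * f \<in> mp.span ?S" if "f \<in> forms s" for f
  proof (rule mult_span_subset[OF mp.subspace_span])
    show "f \<in> mp.span (C \<union> ideal_piece (powers a) s)" using C that by blast
    show "l * f \<in> mp.span ?S" if "f \<in> C \<union> ideal_piece (powers a) s" for f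
      using that ideal_piece_mult[OF _ xl_forms(2), of f "powers a" s]
      by (auto intro: mp.span_base)
  qed
  have "h \<in> mp.span ?S" if "h \<in> ideal_piece (powers_l a) (Suc s)" for h
  proof -
    obtain u f where "u \<in> ideal_piece (powers a) (Suc s)" "f \<in> forms s" "h = u + l * f"
      using ideal_piece_insert_linear[OF \<open>h \<in> _\<close>] by blast
    thus ?thesis using l by (auto intro: mp.span_add mp.span_base)
  qed
  hence "mp.span (G \<union> ideal_piece (powers_l a) (Suc s)) \<subseteq> mp.span ?S"
    by (intro mp.span_minimal) (auto intro: mp.span_base)
  thus ?thesis using G by blast
qed

text \<open>
  If the quotient by the powers and \<open>l\<close> is nonzero in degree \<open>n\<close>, its dimension is bounded by the
  expected one in all degrees up to \<open>n\<close>. Its generators, together with the multiples by \<open>l\<close> of what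
  generates the degree below, generate the quotient by the powers alone.
\<close>

lemma generators_of_quotient:
  assumes "\<not> forms n \<subseteq> ideal_piece (powers_l a) n" "s \<le> n"
  shows "\<exists>B. finite B \<and> int (card B) \<le> (\<Sum>r\<le>s. expected a r) \<and>
    forms s \<subseteq> mp.span (B \<union> ideal_piece (powers a) s)"
  using assms(2)
proof (induction s)
  case 0
  obtain G where "finite G" "int (card G) \<le> expected a 0"
    "forms 0 \<subseteq> mp.span (G \<union> ideal_piece (powers_l a) 0)"
    using expected_codim[of 0 a] codim_0_mono[of 0 a n] assms(1) by blast
  moreover have "mp.span (G \<union> ideal_piece (powers_l a) 0) \<subseteq> mp.span (G \<union> ideal_piece (powers a) 0)"
    using ideal_piece_l_0 by (intro mp.span_mono) blast
  ultimately show ?case by (intro exI[of _ G]) auto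
next
  case (Suc s)
  obtain G where G: "finite G" "int (card G) \<le> expected a (Suc s)"
    "forms (Suc s) \<subseteq> mp.span (G \<union> ideal_piece (powers_l a) (Suc s))"
    using expected_codim[of "Suc s" a] codim_0_mono[of "Suc s" a n] assms(1) Suc.prems by blast
  obtain B where B: "finite B" "int (card B) \<le> (\<Sum>r\<le>s. expected a r)"
    "forms s \<subseteq> mp.span (B \<union> ideal_piece (powers a) s)" using Suc by auto
  have "card (G \<union> (*) l ` B) \<le> card G + card B"
    using card_Un_le[of G "(*) l ` B"] card_image_le[OF B(1), of "(*) l"] by linarith
  hence "int (card (G \<union> (*) l ` B)) \<le> (\<Sum>r\<le>Suc s. expected a r)" using B G by simp
  thus ?case using generate_next[OF B(3) G(3)] B G by (intro exI[of _ "G \<union> (*) l ` B"]) blast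
qed

text \<open>
  Squares arise because \<open>1 + 3 + \<dots> + (2 * n + 1) = (n + 1)\<^sup>2\<close>.
\<close>

lemma sum_expected:
  "(\<Sum>r\<le>n. expected a r) =
     (int n + 1)\<^sup>2 - (\<Sum>k\<in>K. if a k \<le> n then (int n - int (a k) + 1)\<^sup>2 else 0)"
proof (induction n)
  case 0
  have "(\<Sum>k\<in>K. if a k = 0 then 2 * (int 0 - int (a k)) + 1 else 0) =
      (\<Sum>k\<in>K. if a k = 0 then (int 0 - int (a k) + 1)\<^sup>2 else 0)"
    by (rule sum.cong) auto
  thus ?case by (simp add: expected_def)
next
  case (Suc n)
  have eq: "(\<Sum>k\<in>K. if a k \<le> Suc n then (int (Suc n) - int (a k) + 1)\<^sup>2 else 0) =
      (\<Sum>k\<in>K. (if a k \<le> n then (int n - int (a k) + 1)\<^sup>2 else 0) +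
        (if a k \<le> Suc n then 2 * (int (Suc n) - int (a k)) + 1 else 0))"
    by (rule sum.cong) (auto simp: power2_eq_square algebra_simps le_Suc_eq)
  show ?case
    unfolding sum.atMost_Suc Suc expected_def[of a "Suc n"] eq sum.distrib
    by (simp add: power2_eq_square algebra_simps)
qed

text \<open>
  If multiplication by \<open>l\<close> in degree \<open>t\<close> is not surjective, \<open>generators_of_quotient\<close> applies up to degree
  \<open>Suc t\<close>. If in addition it killed some nonzero class \<open>f\<close>, that class could be exchanged for one
  of the generators in degree \<open>t\<close>, and its multiple \<open>l * f\<close> is useless in degree \<open>Suc t\<close>. The quotient in
  degree \<open>Suc t\<close> would then be generated by fewer elements than the lower bound \<open>lower\<close> permits.
\<close>

theorem multiplication_max_rank:
  assumes lower: "\<And>B n. finite B \<Longrightarrow> forms n \<subseteq> mp.span (B \<union> ideal_piece (powers a) n) \<Longrightarrow>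
      (int n + 1)\<^sup>2 \<le> int (card B) + (\<Sum>k\<in>K. if a k \<le> n then (int n - int (a k) + 1)\<^sup>2 else 0)"
  shows "(\<forall>f\<in>forms t. l * f \<in> ideal_piece (powers a) (Suc t) \<longrightarrow> f \<in> ideal_piece (powers a) t) \<or>
    forms (Suc t) \<subseteq> ideal_piece (powers_l a) (Suc t)"
proof (rule ccontr)
  let ?I = "ideal_piece (powers a)"
  assume "\<not> ?thesis"
  then obtain f where f: "f \<in> forms t" "l * f \<in> ?I (Suc t)" "f \<notin> ?I t"
    and n: "\<not> forms (Suc t) \<subseteq> ideal_piece (powers_l a) (Suc t)" by blast
  obtain B where B: "finite B" "int (card B) \<le> (\<Sum>r\<le>t. expected a r)"
    "forms t \<subseteq> mp.span (B \<union> ?I t)"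
    using generators_of_quotient[OF n, of t] by auto
  have "f \<notin> mp.span (?I t)" using f by simp
  then obtain b where b: "b \<in> B" "b \<in> mp.span (insert f ((B - {b}) \<union> ?I t))"
    using span_exchange[OF B(1), of f "?I t"] f B by blast
  let ?C = "insert f (B - {b})"
  have C: "forms t \<subseteq> mp.span (?C \<union> ?I t)"
  proof -
    have "mp.span (B \<union> ?I t) \<subseteq> mp.span (?C \<union> ?I t)"
    proof (intro mp.span_minimal mp.subspace_span subsetI)
      fix v assume "v \<in> B \<union> ?I t"
      thus "v \<in> mp.span (?C \<union> ?I t)" using b(2) by (cases "v = b") (auto intro: mp.span_base)
    qed
    thus ?thesis using B by blast
  qed
  obtain G where G: "finite G" "int (card G) \<le> expected a (Suc t)"
    "forms (Suc t) \<subseteq> mp.span (G \<union> ideal_piece (powers_l a) (Suc t))"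
    using expected_codim[of "Suc t" a] n by blast
  let ?B = "G \<union> (*) l ` (B - {b})"
  have "G \<union> (*) l ` ?C \<union> ?I (Suc t) = ?B \<union> ?I (Suc t)" using f by auto
  hence sp: "forms (Suc t) \<subseteq> mp.span (?B \<union> ?I (Suc t))"
    using generate_next[OF C G(3)] by simp
  have "card ?B \<le> card G + card (B - {b})"
    using card_Un_le[of G "(*) l ` (B - {b})"] card_image_le[of "B - {b}" "(*) l"] B(1) by simp
  moreover have "card (B - {b}) < card B" using b B by (meson card_Diff1_less)
  ultimately have "int (card ?B) < (\<Sum>r\<le>Suc t. expected a r)"
    using B G by simp
  moreover have "finite ?B" using B G by simp
  ultimately show False using lower[OF _ sp] sum_expected[of a "Suc t"] by linarith
qed

end

section \<open>Counting monomials in four variables\<close>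

definition exponents :: "nat \<Rightarrow> (4 \<Rightarrow>\<^sub>0 nat) set" where
  "exponents n = {m. mdeg m = n}"

definition reduced_exponents :: "nat \<Rightarrow> (4 \<Rightarrow>\<^sub>0 nat) set" where
  "reduced_exponents n = {m. mdeg m = n \<and> Poly_Mapping.lookup m 1 \<le> 1}"

definition exponent4 :: "nat \<Rightarrow> nat \<Rightarrow> nat \<Rightarrow> nat \<Rightarrow> 4 \<Rightarrow>\<^sub>0 nat" where
  "exponent4 p q r s = Poly_Mapping.single 1 p + Poly_Mapping.single 2 q +
     Poly_Mapping.single 3 r + Poly_Mapping.single 4 s"

lemma lookup_exponent4:
  "Poly_Mapping.lookup (exponent4 p q r s) 1 = p"
  "Poly_Mapping.lookup (exponent4 p q r s) 2 = q"
  "Poly_Mapping.lookup (exponent4 p q r s) 3 = r"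
  "Poly_Mapping.lookup (exponent4 p q r s) 4 = s"
  by (simp_all add: exponent4_def lookup_add lookup_single)

lemma mdeg_exponent4: "mdeg (exponent4 p q r s) = p + q + r + s"
  by (simp add: exponent4_def)

lemma mdeg_4: "mdeg (m :: 4 \<Rightarrow>\<^sub>0 nat) = Poly_Mapping.lookup m 1 + Poly_Mapping.lookup m 2 +
    Poly_Mapping.lookup m 3 + Poly_Mapping.lookup m 4"
  by (simp add: mdeg_def sum_4)

lemma exponent4_eqI:
  assumes "Poly_Mapping.lookup m 1 = p" "Poly_Mapping.lookup m 2 = q"
    "Poly_Mapping.lookup m 3 = r" "Poly_Mapping.lookup m 4 = s"
  shows "exponent4 p q r s = m"
  by (rule poly_mapping_eqI) (metis assms exhaust_4 lookup_exponent4)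

lemma finite_exponents: "finite (exponents n)"
proof -
  have "exponents n \<subseteq> (\<lambda>(p, q, r, s). exponent4 p q r s) ` ({..n} \<times> {..n} \<times> {..n} \<times> {..n})"
  proof
    fix m assume "m \<in> exponents n"
    thus "m \<in> (\<lambda>(p, q, r, s). exponent4 p q r s) ` ({..n} \<times> {..n} \<times> {..n} \<times> {..n})"
      by (intro image_eqI[of _ _ "(Poly_Mapping.lookup m 1, Poly_Mapping.lookup m 2,
          Poly_Mapping.lookup m 3, Poly_Mapping.lookup m 4)"])
         (auto simp: exponents_def mdeg_4 intro: exponent4_eqI[symmetric])
  qed
  thus ?thesis by (rule finite_subset) auto
qed

text \<open>
  Pairs \<open>(p, q)\<close> in the square with \<open>p + q \<le> n\<close> encode the exponents of the second and third variable
  when the first does not occur; the point reflection of the remaining pairs encodes these exponents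
  when the first variable occurs once.
\<close>

lemma card_reduced_exponents: "card (reduced_exponents n) = (n + 1)\<^sup>2"
proof -
  let ?f = "\<lambda>m. if Poly_Mapping.lookup m 1 = 0
    then (Poly_Mapping.lookup m 2, Poly_Mapping.lookup m 3)
    else (n - Poly_Mapping.lookup m 2, n - Poly_Mapping.lookup m (3 :: 4))"
  let ?g = "\<lambda>(p, q). if p + q \<le> n then exponent4 0 p q (n - p - q)
    else exponent4 1 (n - p) (n - q) (p + q - n - 1)"
  have "bij_betw ?f (reduced_exponents n) ({..n} \<times> {..n})"
  proof (rule bij_betw_byWitness[of _ ?g])
    show "\<forall>m\<in>reduced_exponents n. ?g (?f m) = m"
      by (auto simp: reduced_exponents_def mdeg_4 intro!: exponent4_eqI)
    show "\<forall>z\<in>{..n} \<times> {..n}. ?f (?g z) = z"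
      by (auto simp: lookup_exponent4)
    show "?f ` reduced_exponents n \<subseteq> {..n} \<times> {..n}"
      by (auto simp: reduced_exponents_def mdeg_4)
    show "?g ` ({..n} \<times> {..n}) \<subseteq> reduced_exponents n"
      by (auto simp: reduced_exponents_def mdeg_exponent4 lookup_exponent4)
  qed
  thus ?thesis by (simp add: bij_betw_same_card power2_eq_square)
qed

lemma Var_square_monom:
  "(Var i)\<^sup>2 * monom k = (monom (Poly_Mapping.single i 2 + k) :: ('n, 'k::field) mpoly)"
  by (simp add: Var_def power2_eq_square mult_single numeral_2_eq_2 flip: single_add)

lemma Var1_square_mult:
  "m + 2 = n \<Longrightarrow> p \<in> forms m \<Longrightarrow> (Var 1)\<^sup>2 * p \<in> mp.span (monom ` (exponents n - reduced_exponents n))"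
proof -
  assume m: "m + 2 = n" and p: "p \<in> forms m"
  show ?thesis
  proof (rule mult_span_subset[OF mp.subspace_span _ p[unfolded forms_eq_span]])
    fix f :: "(4, 'a) mpoly" assume "f \<in> {monom k |k. mdeg k = m}"
    then obtain k where k: "f = monom k" "mdeg k = m" by blast
    have "(Var 1)\<^sup>2 * f = monom (Poly_Mapping.single 1 2 + k)"
      by (simp add: k Var_square_monom)
    moreover have "Poly_Mapping.single 1 2 + k \<in> exponents n - reduced_exponents n"
      using k m by (simp add: exponents_def reduced_exponents_def lookup_add)
    ultimately show "(Var 1)\<^sup>2 * f \<in> mp.span (monom ` (exponents n - reduced_exponents n))"
      by (simp add: mp.span_base)
  qed
qed

text \<open>
  Modulo \<open>(Var 1)\<^sup>2\<close>, the multiples of \<open>lam k ^ a k\<close> in degree \<open>n\<close> are spanned by those with reduced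
  monomials of degree \<open>n - a k\<close>, and there are \<open>(n - a k + 1)\<^sup>2\<close> of these. Counting all monomials of degree
  \<open>n\<close> against such a spanning set gives the bound.
\<close>

lemma quotient_dim_lower_bound:
  fixes lam :: "'i \<Rightarrow> (4, 'k::field) mpoly"
  assumes "finite K" and lam: "\<And>k. k \<in> K \<Longrightarrow> lam k \<in> forms 1"
    and B: "finite B" "forms n \<subseteq> mp.span (B \<union>
      ideal_piece (insert ((Var 1)\<^sup>2, 2) ((\<lambda>k. (lam k ^ a k, a k)) ` K)) n)"
  shows "(int n + 1)\<^sup>2 \<le> int (card B) + (\<Sum>k\<in>K. if a k \<le> n then (int n - int (a k) + 1)\<^sup>2 else 0)"
proof -
  define N where "N = exponents n - reduced_exponents n"
  define P where "P k = (if a k \<le> n then (\<lambda>m. lam k ^ a k * monom m) ` reduced_exponents (n - a k) else {})" for k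
  define W where "W = B \<union> (monom ` N \<union> (\<Union>k\<in>K. P k))"
  have fin: "finite (reduced_exponents m)" for m
    by (rule finite_subset[OF _ finite_exponents[of m]]) (auto simp: exponents_def reduced_exponents_def)
  have sq: "(Var 1)\<^sup>2 * p \<in> mp.span W" if "m + 2 = n" "p \<in> forms m" for m p
    using Var1_square_mult[OF that] mp.span_mono[of "monom ` N" W] by (auto simp: N_def W_def)
  have pw: "lam k ^ a k * p \<in> mp.span W" if k: "k \<in> K" and m: "m + a k = n" and p: "p \<in> forms m" for k m p
  proof (rule mult_span_subset[OF mp.subspace_span _ p[unfolded forms_eq_span]])
    fix f :: "(4, 'k) mpoly" assume "f \<in> {monom e |e. mdeg e = m}"
    then obtain e where e: "f = monom e" "mdeg e = m" by blast
    show "lam k ^ a k * f \<in> mp.span W"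
    proof (cases "e \<in> reduced_exponents m")
      case True
      hence "lam k ^ a k * f \<in> P k" using e m by (auto simp: P_def)
      thus ?thesis using k by (auto simp: W_def intro: mp.span_base)
    next
      case False
      define e' where "e' = e - Poly_Mapping.single 1 2"
      have e': "e = Poly_Mapping.single 1 2 + e'"
        using False e by (auto simp: e'_def reduced_exponents_def poly_mapping_eq_iff fun_eq_iff
            lookup_add lookup_minus lookup_single when_def)
      hence m': "mdeg e' + 2 = m" using e by simp
      have "(lam k ^ a k) * monom e' \<in> forms (a k + mdeg e')"
        using forms_power[OF lam[OF k], of "a k"] by (intro forms_mult) (auto simp: forms_iff)
      hence "(Var 1)\<^sup>2 * (lam k ^ a k * monom e') \<in> mp.span W" by (rule sq[rotated]) (use m m' in simp)
      moreover have "f = (Var 1)\<^sup>2 * monom e'"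
        by (simp add: e e' Var_square_monom)
      ultimately show ?thesis by (simp add: mult.left_commute)
    qed
  qed
  have "ideal_piece (insert ((Var 1)\<^sup>2, 2) ((\<lambda>k. (lam k ^ a k, a k)) ` K)) n \<subseteq> mp.span W"
    by (rule ideal_piece_minimal[OF mp.subspace_span]) (use sq pw in auto)
  hence "mp.span (B \<union> ideal_piece (insert ((Var 1)\<^sup>2, 2) ((\<lambda>k. (lam k ^ a k, a k)) ` K)) n) \<subseteq> mp.span W"
    by (intro mp.span_minimal mp.subspace_span) (auto simp: W_def intro: mp.span_base)
  hence "forms n \<subseteq> mp.span W" using B by blast
  hence "monom ` exponents n \<subseteq> mp.span W"
    by (auto simp: exponents_def forms_iff subset_iff)
  moreover have "finite W"
    using B assms(1) fin finite_exponents by (auto simp: W_def P_def N_def)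
  moreover have "mp.independent (monom ` exponents n :: (4, 'k) mpoly set)"
    by (rule mp.independent_mono[OF independent_monoms]) auto
  ultimately have "card (monom ` exponents n :: (4, 'k) mpoly set) \<le> card W"
    using mp.independent_span_bound by blast
  moreover have inj: "inj_on (monom :: _ \<Rightarrow> (4, 'k) mpoly) S" for S
    by (rule inj_onI) (rule monom_inj)
  moreover have "reduced_exponents n \<subseteq> exponents n"
    by (auto simp: exponents_def reduced_exponents_def)
  hence "card (exponents n) = card N + (n + 1)\<^sup>2"
    using finite_exponents[of n] fin[of n] card_mono[of "exponents n" "reduced_exponents n"]
    by (simp add: N_def card_Diff_subset card_reduced_exponents)
  moreover have "card W \<le> card B + (card N + (\<Sum>k\<in>K. card (P k)))"
  proof -
    have "card W \<le> card B + card (monom ` N \<union> (\<Union>k\<in>K. P k) :: (4, 'k) mpoly set)"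
      unfolding W_def by (rule card_Un_le)
    also have "card (monom ` N \<union> (\<Union>k\<in>K. P k) :: (4, 'k) mpoly set) \<le>
        card (monom ` N :: (4, 'k) mpoly set) + card (\<Union>k\<in>K. P k)" by (rule card_Un_le)
    also have "card (\<Union>k\<in>K. P k) \<le> (\<Sum>k\<in>K. card (P k))"
      by (rule card_UN_le[OF assms(1)])
    finally show ?thesis using card_image[OF inj, of N] by simp
  qed
  moreover have "(\<Sum>k\<in>K. int (card (P k))) \<le> (\<Sum>k\<in>K. if a k \<le> n then (int n - int (a k) + 1)\<^sup>2 else 0)"
  proof (rule sum_mono)
    fix k
    have "card (P k) \<le> (n - a k + 1)\<^sup>2" if "a k \<le> n"
    proof -
      have "card (P k) \<le> card (reduced_exponents (n - a k))"
        using that by (simp add: P_def card_image_le fin)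
      thus ?thesis by (simp only: card_reduced_exponents)
    qed
    hence "int (card (P k)) \<le> int ((n - a k + 1)\<^sup>2)" if "a k \<le> n"
      using that by (simp only: of_nat_le_iff)
    thus "int (card (P k)) \<le> (if a k \<le> n then (int n - int (a k) + 1)\<^sup>2 else 0)"
      by (auto simp: P_def of_nat_diff add.commute)
  qed
  ultimately have "(n + 1)\<^sup>2 \<le> card B + (\<Sum>k\<in>K. card (P k))"
    by (simp add: card_image)
  hence "int ((n + 1)\<^sup>2) \<le> int (card B) + (\<Sum>k\<in>K. int (card (P k)))"
    by (metis of_nat_add of_nat_le_iff of_nat_sum)
  thus ?thesis
    using \<open>(\<Sum>k\<in>K. int (card (P k))) \<le> _\<close> by (simp add: add.commute)
qed

section \<open>Homogeneous ideals\<close>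

lift_definition hom_component :: "nat \<Rightarrow> ('n::finite, 'k::field) mpoly \<Rightarrow> ('n, 'k) mpoly" is
  "\<lambda>n f m. if mdeg m = n then f m else 0"
  by (erule rev_finite_subset) auto

lemma hom_component_add: "hom_component n (f + g) = hom_component n f + hom_component n g"
  by (rule poly_mapping_eqI) (simp add: hom_component.rep_eq lookup_add)

lemma hom_component_smul: "hom_component n (smul c f) = smul c (hom_component n f)"
  by (rule poly_mapping_eqI) (simp add: hom_component.rep_eq)

lemma hom_component_0 [simp]: "hom_component n 0 = 0"
  by (rule poly_mapping_eqI) (simp add: hom_component.rep_eq)

lemma hom_component_forms:
  assumes "f \<in> forms m" shows "hom_component n f = (if m = n then f else 0)"
proof (rule poly_mapping_eqI)
  fix k
  show "Poly_Mapping.lookup (hom_component n f) k = Poly_Mapping.lookup (if m = n then f else 0) k"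
    using assms by (cases "k \<in> Poly_Mapping.keys f")
      (auto simp: hom_component.rep_eq forms_iff in_keys_iff)
qed

lemma monom_in_forms: "monom m \<in> forms (mdeg m)"
  by (simp add: forms_iff)

lemma hom_component_monom_mult:
  "hom_component n (monom m * f) = (if mdeg m \<le> n then monom m * hom_component (n - mdeg m) f else 0)"
proof -
  have "f \<in> mp.span (range monom)" by (simp add: span_monoms)
  thus ?thesis
  proof (induction rule: mp.span_induct_alt)
    case (step c g h)
    then obtain k where "g = monom k" by blast
    thus ?case using step
      by (auto simp: distrib_left hom_component_add hom_component_smul mult_single
          hom_component_forms[OF monom_in_forms])
  qed simp
qed

lemma poly_ring_simps [simp]:
  "carrier poly_ring = UNIV" "mult poly_ring = (*)" "add poly_ring = (+)" "zero poly_ring = 0"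
  by (simp_all add: poly_ring_def)

lemma ideal_poly_ringD:
  fixes I :: "('n, 'k::field) mpoly set"
  assumes "ideal I poly_ring"
  shows "0 \<in> I" "f \<in> I \<Longrightarrow> g \<in> I \<Longrightarrow> f + g \<in> I" "f \<in> I \<Longrightarrow> r * f \<in> I" "f \<in> I \<Longrightarrow> g \<in> I \<Longrightarrow> f - g \<in> I"
proof -
  interpret ideal I poly_ring by fact
  show "0 \<in> I" using additive_subgroup.zero_closed[OF additive_subgroup_axioms] by simp
  show add: "f + g \<in> I" if "f \<in> I" "g \<in> I" for f g using additive_subgroup.a_closed[OF additive_subgroup_axioms that] by simp
  show mult: "r * f \<in> I" if "f \<in> I" for f r using I_l_closed[OF that, of r] by simp
  show "f - g \<in> I" if "f \<in> I" "g \<in> I" using add[OF that(1) mult[OF that(2), of "-1"]] by simp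
qed

lemma ideal_poly_ringI:
  fixes I :: "('n, 'k::field) mpoly set"
  assumes "0 \<in> I" and add: "\<And>f g. f \<in> I \<Longrightarrow> g \<in> I \<Longrightarrow> f + g \<in> I"
    and mult: "\<And>f r. f \<in> I \<Longrightarrow> r * f \<in> I"
  shows "ideal I poly_ring"
proof -
  interpret R: cring "poly_ring :: ('n, 'k) mpoly ring" by (rule cring_poly_ring)
  show ?thesis
  proof (rule idealI)
    show "subgroup I (add_monoid poly_ring)"
    proof (rule R.add.subgroupI)
      fix f assume f: "f \<in> I"
      have "\<ominus>\<^bsub>poly_ring\<^esub> f = - f" by (rule R.minus_equality) simp_all
      thus "\<ominus>\<^bsub>poly_ring\<^esub> f \<in> I" using mult[OF f, of "-1"] by simp
    qed (use assms in auto)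
  qed (use mult in \<open>auto simp: R.ring_axioms mult.commute\<close>)
qed

text \<open>
  The polynomials all of whose homogeneous components lie in the pieces \<open>ideal_piece X n\<close> form an ideal
  that contains the generators.
\<close>

lemma mem_genideal_iff:
  fixes X :: "(('n::finite, 'k::field) mpoly \<times> nat) set"
  assumes X: "\<And>g d. (g, d) \<in> X \<Longrightarrow> g \<in> forms d" and f: "f \<in> forms n"
  shows "f \<in> Idl\<^bsub>poly_ring\<^esub> (fst ` X) \<longleftrightarrow> f \<in> ideal_piece X n"
proof
  interpret R: cring "poly_ring :: ('n, 'k) mpoly ring" by (rule cring_poly_ring)
  let ?I = "Idl\<^bsub>poly_ring\<^esub> (fst ` X)"
  have I: "ideal ?I poly_ring" by (rule R.genideal_ideal) simp
  have gen: "fst ` X \<subseteq> ?I" by (rule R.genideal_self) simp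
  have "mp.subspace ?I"
    unfolding mp.subspace_def using ideal_poly_ringD[OF I] by (auto simp: smul_def)
  hence "ideal_piece X n \<subseteq> ?I"
  proof (rule ideal_piece_minimal)
    fix g p :: "('n, 'k) mpoly" and d m assume "(g, d) \<in> X"
    hence "g \<in> ?I" using gen by force
    thus "g * p \<in> ?I" using ideal_poly_ringD(3)[OF I, of g p] by (simp add: mult.commute)
  qed
  thus "f \<in> ideal_piece X n \<Longrightarrow> f \<in> ?I" by blast
  define J where "J = {f. \<forall>n. hom_component n f \<in> ideal_piece X n}"
  have "ideal J poly_ring"
  proof (rule ideal_poly_ringI)
    show "0 \<in> J" by (simp add: J_def mp.subspace_0[OF subspace_ideal_piece])
    show add: "f + g \<in> J" if "f \<in> J" "g \<in> J" for f g
      using that by (auto simp: J_def hom_component_add intro: mp.subspace_add subspace_ideal_piece)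
    have smul: "smul c f \<in> J" if "f \<in> J" for c f
      using that by (auto simp: J_def hom_component_smul intro: mp.subspace_scale subspace_ideal_piece)
    have mon: "monom m * f \<in> J" if "f \<in> J" for m f
      unfolding J_def
    proof (intro CollectI allI)
      fix n
      show "hom_component n (monom m * f) \<in> ideal_piece X n"
        using that ideal_piece_mult[OF _ monom_in_forms, of "hom_component (n - mdeg m) f" X "n - mdeg m" m]
        by (auto simp: J_def hom_component_monom_mult mp.subspace_0[OF subspace_ideal_piece])
    qed
    show "r * f \<in> J" if f: "f \<in> J" for f r
    proof -
      have "r \<in> mp.span (range monom)" by (simp add: span_monoms)
      thus ?thesis
      proof (induction rule: mp.span_induct_alt)
        case base
        show ?case using \<open>0 \<in> J\<close> by simp
      next
        case (step c g h)
        thus ?case using add smul mon f by (auto simp: distrib_right)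
      qed
    qed
  qed
  moreover have "fst ` X \<subseteq> J"
  proof
    fix g assume "g \<in> fst ` X"
    then obtain d where d: "(g, d) \<in> X" by force
    have "g \<in> ideal_piece X d" using ideal_piece_base[OF d one_in_forms, of d] by simp
    thus "g \<in> J"
      using X[OF d] by (auto simp: J_def hom_component_forms mp.subspace_0[OF subspace_ideal_piece])
  qed
  ultimately have "?I \<subseteq> J" by (rule R.genideal_minimal)
  hence "hom_component n f \<in> ideal_piece X n" if "f \<in> ?I"
    using that by (auto simp: J_def)
  thus "f \<in> ?I \<Longrightarrow> f \<in> ideal_piece X n" by (simp add: hom_component_forms[OF f])
qed

section \<open>Maximal rank in terms of representatives\<close>

lemma coset_eq_iff:
  fixes I :: "('n, 'k::field) mpoly set"
  assumes I: "ideal I poly_ring"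
  shows "I +>\<^bsub>poly_ring\<^esub> f = I +>\<^bsub>poly_ring\<^esub> g \<longleftrightarrow> f - g \<in> I"
proof -
  have coset: "I +>\<^bsub>poly_ring\<^esub> f = (\<lambda>h. h + f) ` I" for f
    by (auto simp: a_r_coset_def')
  show ?thesis unfolding coset
  proof
    assume "(\<lambda>h. h + f) ` I = (\<lambda>h. h + g) ` I"
    moreover have "f \<in> (\<lambda>h. h + f) ` I" using ideal_poly_ringD(1)[OF I] by force
    ultimately obtain h where "h \<in> I" "f = h + g" by blast
    thus "f - g \<in> I" by simp
  next
    assume fg: "f - g \<in> I"
    show "(\<lambda>h. h + f) ` I = (\<lambda>h. h + g) ` I"
    proof (intro equalityI subsetI; elim imageE)
      fix u h assume "u = h + f" "h \<in> I"
      thus "u \<in> (\<lambda>h. h + g) ` I"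
        using ideal_poly_ringD(2)[OF I, of h "f - g"] fg by (intro image_eqI[of _ _ "h + (f - g)"]) auto
    next
      fix u h assume "u = h + g" "h \<in> I"
      thus "u \<in> (\<lambda>h. h + f) ` I"
        using ideal_poly_ringD(4)[OF I, of h "f - g"] fg by (intro image_eqI[of _ _ "h - (f - g)"]) auto
    qed
  qed
qed

lemma quot_times_coset:
  assumes "ideal I poly_ring"
  shows "quot_times I l (I +>\<^bsub>poly_ring\<^esub> f) = I +>\<^bsub>poly_ring\<^esub> (l * f)"
  using ideal.rcoset_mult_add[OF assms, of l f] by (simp add: quot_times_def FactRing_def)

lemma max_rank_criterion:
  fixes I :: "('n::finite, 'k::field) mpoly set"
  assumes I: "ideal I poly_ring" and l: "l \<in> forms 1"
    and nat: "\<And>n. (\<forall>f\<in>forms n. l * f \<in> I \<longrightarrow> f \<in> I) \<or>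
      (\<forall>h\<in>forms (Suc n). \<exists>f\<in>forms n. h - l * f \<in> I)"
  shows "inj_on (quot_times I l) (quot_piece I t) \<or>
     quot_times I l ` quot_piece I t = quot_piece I (t + 1)"
proof (cases "t < 0")
  case True
  have "graded_piece t = ({0} :: ('n, 'k) mpoly set)"
  proof (intro equalityI subsetI)
    fix f :: "('n, 'k) mpoly" assume "f \<in> graded_piece t"
    hence "Poly_Mapping.keys f = {}" using True by (force simp: graded_piece_def)
    thus "f \<in> {0}" by (auto intro!: poly_mapping_eqI simp: in_keys_iff)
  qed (simp add: graded_piece_def)
  thus ?thesis by (simp add: quot_piece_def)
next
  case False
  then obtain n where n: "t = int n" by (metis nat_0_le not_le)
  have t: "graded_piece t = (forms n :: ('n, 'k) mpoly set)"
    "graded_piece (t + 1) = (forms (Suc n) :: ('n, 'k) mpoly set)"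
    by (simp_all add: forms_def n add.commute)
  from nat[of n] show ?thesis
  proof
    assume inj: "\<forall>f\<in>forms n. l * f \<in> I \<longrightarrow> f \<in> I"
    have "inj_on (quot_times I l) (quot_piece I t)"
    proof (rule inj_onI)
      fix u v assume "u \<in> quot_piece I t" "v \<in> quot_piece I t"
        and eq: "quot_times I l u = quot_times I l v"
      then obtain f g where fg: "f \<in> forms n" "g \<in> forms n"
        "u = I +>\<^bsub>poly_ring\<^esub> f" "v = I +>\<^bsub>poly_ring\<^esub> g"
        by (auto simp: quot_piece_def t)
      have "l * (f - g) \<in> I"
        using eq fg by (simp add: quot_times_coset[OF I] coset_eq_iff[OF I] right_diff_distrib)
      moreover have "f - g \<in> forms n" using fg by (intro mp.subspace_diff subspace_forms)
      ultimately show "u = v" using inj fg by (simp add: coset_eq_iff[OF I])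
    qed
    thus ?thesis ..
  next
    assume surj: "\<forall>h\<in>forms (Suc n). \<exists>f\<in>forms n. h - l * f \<in> I"
    have "quot_times I l ` quot_piece I t = quot_piece I (t + 1)"
    proof (intro equalityI subsetI)
      fix u assume "u \<in> quot_times I l ` quot_piece I t"
      then obtain f where "f \<in> forms n" "u = I +>\<^bsub>poly_ring\<^esub> (l * f)"
        by (auto simp: quot_piece_def t quot_times_coset[OF I])
      thus "u \<in> quot_piece I (t + 1)"
        using forms_mult[OF l, of f n] by (auto simp: quot_piece_def t)
    next
      fix u assume "u \<in> quot_piece I (t + 1)"
      then obtain h where h: "h \<in> forms (Suc n)" "u = I +>\<^bsub>poly_ring\<^esub> h"
        by (auto simp: quot_piece_def t)
      then obtain f where f: "f \<in> forms n" "h - l * f \<in> I" using surj by blast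
      hence "u = quot_times I l (I +>\<^bsub>poly_ring\<^esub> f)"
        using h by (simp add: quot_times_coset[OF I] coset_eq_iff[OF I])
      thus "u \<in> quot_times I l ` quot_piece I t" using f by (auto simp: quot_piece_def t)
    qed
    thus ?thesis ..
  qed
qed

section \<open>Zariski open sets\<close>

lemma eval_mpoly_superset:
  assumes "finite A" "Poly_Mapping.keys f \<subseteq> A"
  shows "eval_mpoly f c = (\<Sum>m\<in>A. Poly_Mapping.lookup f m * (\<Prod>i\<in>UNIV. c i ^ Poly_Mapping.lookup m i))"
  unfolding eval_mpoly_def by (rule sum.mono_neutral_left) (use assms in \<open>auto simp: in_keys_iff\<close>)

lemma eval_mpoly_add: "eval_mpoly (f + g) c = eval_mpoly f c + eval_mpoly g c"
proof -
  let ?A = "Poly_Mapping.keys f \<union> Poly_Mapping.keys g"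
  have "Poly_Mapping.keys (f + g) \<subseteq> ?A" by (rule keys_add)
  thus ?thesis
    by (simp add: eval_mpoly_superset[of ?A] lookup_add distrib_right sum.distrib)
qed

lemma eval_mpoly_smul: "eval_mpoly (smul b f) c = b * eval_mpoly f c"
  using keys_smul[of b f]
  by (simp add: eval_mpoly_superset[of "Poly_Mapping.keys f"] sum_distrib_left mult.assoc)

lemma eval_mpoly_monom: "eval_mpoly (monom m) c = (\<Prod>i\<in>UNIV. c i ^ Poly_Mapping.lookup m i)"
  by (simp add: eval_mpoly_def)

lemma eval_mpoly_0 [simp]: "eval_mpoly 0 c = 0"
  by (simp add: eval_mpoly_def)

lemma eval_mpoly_mult: "eval_mpoly (f * g) c = eval_mpoly f c * eval_mpoly g c"
proof -
  have mm: "eval_mpoly (monom m * monom m') c = eval_mpoly (monom m) c * eval_mpoly (monom m') c" for m m'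
    by (simp add: mult_single eval_mpoly_monom lookup_add power_add prod.distrib)
  have m: "eval_mpoly (monom m * g) c = eval_mpoly (monom m) c * eval_mpoly g c" for m
  proof -
    have "g \<in> mp.span (range monom)" by (simp add: span_monoms)
    thus ?thesis
      by (induction rule: mp.span_induct_alt)
         (auto simp: mm eval_mpoly_add eval_mpoly_smul distrib_left)
  qed
  have "f \<in> mp.span (range monom)" by (simp add: span_monoms)
  thus ?thesis
    by (induction rule: mp.span_induct_alt)
       (auto simp: m eval_mpoly_add eval_mpoly_smul distrib_right mult.assoc)
qed

lemma eval_mpoly_Var: "eval_mpoly (Var i) c = c i"
proof -
  have "(\<Prod>j\<in>UNIV. c j ^ Poly_Mapping.lookup (Poly_Mapping.single i (Suc 0)) j) =
      (\<Prod>j\<in>UNIV. if i = j then c j else 1)"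
    by (rule prod.cong) (auto simp: lookup_single)
  thus ?thesis by (simp add: Var_def eval_mpoly_monom)
qed

lemma eval_mpoly_linear_form: "eval_mpoly (linear_form v) c = (\<Sum>i\<in>UNIV. v i * c i)"
proof -
  have "eval_mpoly (\<Sum>i\<in>A. smul (v i) (Var i)) c = (\<Sum>i\<in>A. v i * c i)" if "finite A" for A
    using that by (induction A rule: finite_induct)
      (simp_all add: eval_mpoly_add eval_mpoly_smul eval_mpoly_Var)
  thus ?thesis by (simp add: linear_form_eq)
qed

text \<open>
  The union of finitely many hyperplanes is the zero set of the product of their equations.
\<close>

lemma zariski_open_hyperplanes:
  fixes V :: "('n::finite \<Rightarrow> 'k::field) set"
  assumes "finite V"
  shows "zariski_open {c. \<forall>v\<in>V. (\<Sum>i\<in>UNIV. v i * c i) \<noteq> 0}"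
proof -
  let ?f = "\<Prod>v\<in>V. linear_form v"
  have "eval_mpoly ?f c = (\<Prod>v\<in>V. \<Sum>i\<in>UNIV. v i * c i)" for c
    using assms
  proof (induction V rule: finite_induct)
    case empty
    show ?case using eval_mpoly_monom[of 0 c] by simp
  qed (simp add: eval_mpoly_mult eval_mpoly_linear_form)
  hence "- {c. \<forall>v\<in>V. (\<Sum>i\<in>UNIV. v i * c i) \<noteq> 0} = {c. \<forall>f\<in>{?f}. eval_mpoly f c = 0}"
    using assms by (auto simp: prod_zero_iff)
  thus ?thesis unfolding zariski_open_def zariski_closed_def by blast
qed

section \<open>General position\<close>

lemma linear_form_comb:
  "linear_form (\<lambda>i. p * b i - q * c i) = smul p (linear_form b) - smul q (linear_form c)"
  by (simp add: linear_form_eq mp.scale_left_diff_distrib mp.scale_sum_right sum_subtractf)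

lemma Var_in_span:
  assumes "linear_form c \<in> mp.span S" "c q \<noteq> 0"
    and "\<And>j. j \<noteq> q \<Longrightarrow> c j \<noteq> 0 \<Longrightarrow> Var j \<in> mp.span S"
  shows "Var q \<in> mp.span S"
proof -
  have "linear_form c = smul (c q) (Var q) + (\<Sum>j\<in>UNIV - {q}. smul (c j) (Var j))"
    by (simp add: linear_form_eq sum.remove[of UNIV q])
  hence "smul (c q) (Var q) = linear_form c - (\<Sum>j\<in>UNIV - {q}. smul (c j) (Var j))" by simp
  moreover have "(\<Sum>j\<in>UNIV - {q}. smul (c j) (Var j)) \<in> mp.span S"
  proof (rule mp.span_sum)
    fix j assume "j \<in> UNIV - {q}"
    thus "smul (c j) (Var j) \<in> mp.span S"
      using assms(3)[of j] by (cases "c j = 0") (auto intro: mp.span_scale mp.span_zero)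
  qed
  ultimately have "smul (c q) (Var q) \<in> mp.span S" using assms by (simp add: mp.span_diff)
  hence "smul (1 / c q) (smul (c q) (Var q)) \<in> mp.span S" by (rule mp.span_scale)
  thus ?thesis using assms(2) by simp
qed

lemma forms_1_span_one:
  assumes "linear_form c \<in> mp.span S" "c q \<noteq> 0" "\<And>j. j \<noteq> q \<Longrightarrow> Var j \<in> mp.span S"
  shows "forms 1 \<subseteq> mp.span S"
proof -
  have "Var j \<in> mp.span S" for j
    using assms(3) Var_in_span[OF assms(1,2)] by (cases "j = q") auto
  thus ?thesis unfolding forms_1_eq_span by (intro mp.span_minimal) auto
qed

lemma forms_1_span_two:
  assumes "linear_form b \<in> mp.span S" "linear_form c \<in> mp.span S"
    and "p \<noteq> q" "c p \<noteq> 0" "b p * c q - b q * c p \<noteq> 0"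
    and Var: "\<And>j. j \<noteq> p \<Longrightarrow> j \<noteq> q \<Longrightarrow> Var j \<in> mp.span S"
  shows "forms 1 \<subseteq> mp.span S"
proof (rule forms_1_span_one[OF assms(2,4)])
  have "linear_form (\<lambda>i. c p * b i - b p * c i) \<in> mp.span S"
    unfolding linear_form_comb using assms by (intro mp.span_diff mp.span_scale)
  hence "Var q \<in> mp.span S"
  proof (rule Var_in_span)
    show "c p * b q - b p * c q \<noteq> 0" using assms by (simp add: mult.commute)
    show "Var j \<in> mp.span S" if "j \<noteq> q" "c p * b j - b p * c j \<noteq> 0" for j
      using that Var by (cases "j = p") (auto simp: mult.commute)
  qed
  thus "Var j \<in> mp.span S" if "j \<noteq> p" for j using that Var by (cases "j = q") auto
qed

lemma dirderiv_Var: "dirderiv d (Var i) = smul (d i) 1"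
  by (simp add: dirderiv_def pderiv_mp_Var if_distrib[of "smul _"] cong: if_cong)

text \<open>
  Modulo \<open>linear_form c\<close>, the four variables and \<open>linear_form b\<close> are five linear forms in three variables.
  The conditions say that no three of them are linearly dependent. The derivations needed are
  explicit cross products.
\<close>

lemma general_forms_of_minors:
  fixes b c :: "4 \<Rightarrow> 'k::field_char_0"
  assumes b: "\<And>i. b i \<noteq> 0" and c: "\<And>i. c i \<noteq> 0"
    and minor: "\<And>p q. p \<noteq> q \<Longrightarrow> b p * c q - b q * c p \<noteq> 0"
  shows "general_forms (Var 1) (linear_form c)
    (\<lambda>k. if k = 1 then linear_form b else Var k) UNIV"
proof
  let ?lam = "\<lambda>k. if k = 1 then linear_form b else Var k"
  show "finite (UNIV :: 4 set)" "(UNIV :: 4 set) \<noteq> {}" "card (UNIV :: 4 set) \<le> 4" by simp_all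
  show "?lam k \<in> forms 1" for k by simp
  show "\<exists>d y. adapted_derivation d (Var 1) (linear_form c) (?lam i) y \<and>
      (\<forall>k\<in>UNIV - {i}. \<exists>\<delta>. \<delta> \<noteq> 0 \<and> dirderiv d (?lam k) = smul \<delta> 1)" for i
  proof (cases "i = 1")
    case True
    define d where "d j = (if j = 2 then b 3 * c 4 - b 4 * c 3 else if j = 3 then b 4 * c 2 - b 2 * c 4
      else if j = 4 then b 2 * c 3 - b 3 * c 2 else 0)" for j :: 4
    have d: "d j \<noteq> 0" if "j \<noteq> 1" for j
      using that exhaust_4[of j] minor[of 3 4] minor[of 4 2] minor[of 2 3] by (auto simp: d_def)
    define y :: "(4, 'k) mpoly" where "y = smul (1 / d 2) (Var 2)"
    have V2: "Var 2 = smul (d 2) y" using d[of 2] by (simp add: y_def)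
    have "adapted_derivation d (Var 1) (linear_form c) (linear_form b) y"
    proof
      have d1: "d 1 = 0" by (simp add: d_def)
      show "y \<in> forms 1" unfolding y_def by (intro mp.subspace_scale subspace_forms) simp
      show "dirderiv d (Var 1) = 0" by (simp add: dirderiv_Var d1)
      show "dirderiv d (linear_form c) = 0" "dirderiv d (linear_form b) = 0"
        by (simp_all add: dirderiv_linear_form sum_4) (simp_all add: d_def algebra_simps)
      show "dirderiv d y = 1" using d[of 2] by (simp add: y_def dirderiv_smul dirderiv_Var)
      show "forms 1 \<subseteq> mp.span {Var 1, linear_form c, linear_form b, y}" (is "_ \<subseteq> mp.span ?S")
      proof (rule forms_1_span_two)
        show "linear_form b \<in> mp.span ?S" "linear_form c \<in> mp.span ?S"
          by (auto intro: mp.span_base)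
        show "(3::4) \<noteq> 4" "c 3 \<noteq> 0" "b 3 * c 4 - b 4 * c 3 \<noteq> 0" using c minor[of 3 4] by auto
        fix j :: 4 assume "j \<noteq> 3" "j \<noteq> 4"
        hence "j = 1 \<or> j = 2" using exhaust_4[of j] by auto
        moreover have "Var 2 \<in> mp.span ?S" unfolding V2 by (intro mp.span_scale mp.span_base) simp
        ultimately show "Var j \<in> mp.span ?S" by (auto intro: mp.span_base)
      qed
    qed simp_all
    moreover have "\<forall>k\<in>UNIV - {i}. \<exists>\<delta>. \<delta> \<noteq> 0 \<and> dirderiv d (?lam k) = smul \<delta> 1"
      using True d by (auto simp: dirderiv_Var)
    ultimately show ?thesis using True by auto
  next
    case False
    obtain p q where pq: "UNIV = {1, i, p, q}" "p \<noteq> 1" "q \<noteq> 1" "p \<noteq> i" "q \<noteq> i" "p \<noteq> q"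
    proof -
      from False exhaust_4[of i] consider "i = 2" | "i = 3" | "i = 4" by auto
      thus ?thesis
      proof cases
        case 1
        show ?thesis by (rule that[of 3 4]) (use 1 UNIV_4 in simp_all)
      next
        case 2
        show ?thesis by (rule that[of 2 4]) (use 2 UNIV_4 in \<open>simp_all add: insert_commute\<close>)
      next
        case 3
        show ?thesis by (rule that[of 2 3]) (use 3 UNIV_4 in \<open>simp_all add: insert_commute\<close>)
      qed
    qed
    have sum: "(\<Sum>j\<in>UNIV. f j) = f 1 + f i + f p + f q" for f :: "4 \<Rightarrow> 'k"
      unfolding pq(1) using pq(2-) False by (simp add: add.assoc)
    define d where "d j = (if j = p then c q else if j = q then - c p else 0)" for j
    define y :: "(4, 'k) mpoly" where "y = smul (1 / c q) (Var p)"
    have Vp: "Var p = smul (c q) y" using c[of q] by (simp add: y_def)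
    have ad: "adapted_derivation d (Var 1) (linear_form c) (Var i) y"
    proof
      show "y \<in> forms 1" unfolding y_def by (intro mp.subspace_scale subspace_forms) simp
      show "dirderiv d (Var 1) = 0" "dirderiv d (Var i) = 0"
        using pq by (simp_all add: dirderiv_Var d_def)
      show "dirderiv d (linear_form c) = 0"
        unfolding dirderiv_linear_form sum using pq False by (simp add: d_def mult.commute)
      show "dirderiv d y = 1" using c[of q] by (simp add: y_def dirderiv_smul dirderiv_Var d_def)
      show "forms 1 \<subseteq> mp.span {Var 1, linear_form c, Var i, y}" (is "_ \<subseteq> mp.span ?S")
      proof (rule forms_1_span_one)
        show "linear_form c \<in> mp.span ?S" "c q \<noteq> 0" using c by (auto intro: mp.span_base)
        fix j assume "j \<noteq> q"
        hence "j = 1 \<or> j = i \<or> j = p" using pq(1) by blast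
        moreover have "Var p \<in> mp.span ?S" unfolding Vp by (intro mp.span_scale mp.span_base) simp
        ultimately show "Var j \<in> mp.span ?S" by (auto intro: mp.span_base)
      qed
    qed simp_all
    have others: "\<exists>\<delta>. \<delta> \<noteq> 0 \<and> dirderiv d (?lam k) = smul \<delta> 1" if "k \<noteq> i" for k
    proof -
      have k: "k = 1 \<or> k = p \<or> k = q" using that pq(1) by blast
      show ?thesis
      proof (cases "k = 1")
        case True
        have "dirderiv d (?lam k) = smul (b p * c q - b q * c p) 1"
          using pq False unfolding if_P[OF True] dirderiv_linear_form sum
          by (simp add: d_def mult.commute)
        thus ?thesis using minor[OF pq(6)] by blast
      next
        case k1: False
        hence "dirderiv d (?lam k) = smul (d k) 1" by (simp add: dirderiv_Var)
        moreover have "d k \<noteq> 0" using k k1 c by (auto simp: d_def)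
        ultimately show ?thesis by blast
      qed
    qed
    show ?thesis
    proof (intro exI[of _ d] exI[of _ y] conjI ballI)
      show "adapted_derivation d (Var 1) (linear_form c) (?lam i) y" using ad False by simp
      fix k assume "k \<in> UNIV - {i}"
      thus "\<exists>\<delta>. \<delta> \<noteq> 0 \<and> dirderiv d (?lam k) = smul \<delta> 1" using others by blast
    qed
  qed
  show "forms 1 \<subseteq> mp.span (insert (linear_form c) (?lam ` T))" if T: "card T = 3" for T
  proof -
    let ?S = "insert (linear_form c) (?lam ` T)"
    have "card (- T) = 1" using T by (simp add: Compl_eq_Diff_UNIV card_Diff_subset)
    then obtain m where m: "- T = {m}" by (auto simp: card_1_singleton_iff)
    hence T: "j \<in> T \<longleftrightarrow> j \<noteq> m" for j by blast
    have Var: "Var j \<in> mp.span ?S" if "j \<noteq> 1" "j \<noteq> m" for j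
      using that T by (intro mp.span_base) force
    have lc: "linear_form c \<in> mp.span ?S" by (auto intro: mp.span_base)
    show ?thesis
    proof (cases "m = 1")
      case True
      thus ?thesis using forms_1_span_one[OF lc c[of 1]] Var by auto
    next
      case False
      have lb: "linear_form b \<in> mp.span ?S"
        using False T[of 1] by (intro mp.span_base) force
      show ?thesis
        by (rule forms_1_span_two[OF lb lc _ c[of 1] minor[of 1 m]]) (use False Var in auto)
    qed
  qed
qed

text \<open>
  The open set of good linear forms is the complement of hyperplanes: those of linear forms with a
  vanishing coefficient, and those where a minor formed with \<open>b\<close> vanishes.
\<close>

theorem has_WLP_all_nonzero:
  fixes b :: "4 \<Rightarrow> 'k::field_char_0" and a :: "4 \<Rightarrow> nat"
  assumes b: "\<And>i. b i \<noteq> 0"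
  defines "lam \<equiv> \<lambda>k. if k = 1 then linear_form b else Var k"
  shows "has_WLP (Idl\<^bsub>poly_ring\<^esub> (fst ` insert ((Var 1)\<^sup>2, 2) (range (\<lambda>k. (lam k ^ a k, a k)))))"
proof -
  let ?X = "insert ((Var 1)\<^sup>2, 2) (range (\<lambda>k. (lam k ^ a k, a k)))"
  let ?I = "Idl\<^bsub>poly_ring\<^esub> (fst ` ?X)"
  interpret R: cring "poly_ring :: (4, 'k) mpoly ring" by (rule cring_poly_ring)
  have I: "ideal ?I poly_ring" by (rule R.genideal_ideal) simp
  define e :: "4 \<Rightarrow> 4 \<Rightarrow> 'k" where "e p i = (if i = p then 1 else 0)" for p i
  define V where "V = range e \<union> (\<lambda>(p, q) i. b p * e q i - b q * e p i) ` {(p, q). p \<noteq> q}"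
  define U where "U = {c. \<forall>v\<in>V. (\<Sum>i\<in>UNIV. v i * c i) \<noteq> 0}"
  have sum_e: "(\<Sum>i\<in>UNIV. e p i * c i) = c p" for p and c :: "4 \<Rightarrow> 'k"
    by (simp add: e_def if_distrib[of "\<lambda>x. x * _"] cong: if_cong)
  have sum_minor: "(\<Sum>i\<in>UNIV. (b p * e q i - b q * e p i) * c i) = b p * c q - b q * c p" for p q and c :: "4 \<Rightarrow> 'k"
    by (simp add: left_diff_distrib sum_subtractf mult.assoc sum_e flip: sum_distrib_left)
  have U: "c \<in> U \<longleftrightarrow> (\<forall>i. c i \<noteq> 0) \<and> (\<forall>p q. p \<noteq> q \<longrightarrow> b p * c q - b q * c p \<noteq> 0)" for c
    by (auto simp: U_def V_def ball_Un sum_e sum_minor)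
  have "zariski_open U" unfolding U_def by (rule zariski_open_hyperplanes) (simp add: V_def)
  moreover have "U \<noteq> {}"
  proof -
    \<comment> \<open>Scaling the coefficients of \<open>b\<close> by distinct nonzero numbers makes all minors nonzero.\<close>
    define w :: "4 \<Rightarrow> 'k" where "w i = (if i = 1 then 1 else if i = 2 then 2 else if i = 3 then 3 else 4)" for i
    have "w p \<noteq> w q" if "p \<noteq> q" for p q
      using that exhaust_4[of p] exhaust_4[of q] by (auto simp: w_def)
    hence "b p * (b q * w q) - b q * (b p * w p) \<noteq> 0" if "p \<noteq> q" for p q
      using that b[of p] b[of q] by (auto simp: mult.left_commute)
    hence "(\<lambda>i. b i * w i) \<in> U" using b by (auto simp: U w_def)
    thus ?thesis by blast
  qed
  moreover have "inj_on (quot_times ?I (linear_form c)) (quot_piece ?I t) \<or>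
      quot_times ?I (linear_form c) ` quot_piece ?I t = quot_piece ?I (t + 1)" if c: "c \<in> U" for c t
  proof (rule max_rank_criterion[OF I])
    let ?l = "linear_form c"
    show "?l \<in> forms 1" by simp
    interpret G: general_forms "Var 1" ?l lam UNIV
      unfolding lam_def by (rule general_forms_of_minors) (use b c U in auto)
    have X: "g \<in> forms d" if "(g, d) \<in> ?X" for g d
      by (rule G.powers_l_forms[of _ _ a]) (use that in auto)
    fix n
    have "(\<forall>f\<in>forms n. ?l * f \<in> ideal_piece ?X (Suc n) \<longrightarrow> f \<in> ideal_piece ?X n) \<or>
        forms (Suc n) \<subseteq> ideal_piece (insert (?l, 1) ?X) (Suc n)"
      by (rule G.multiplication_max_rank, rule quotient_dim_lower_bound)
         (use G.lam_forms in auto)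
    thus "(\<forall>f\<in>forms n. ?l * f \<in> ?I \<longrightarrow> f \<in> ?I) \<or>
        (\<forall>h\<in>forms (Suc n). \<exists>f\<in>forms n. h - ?l * f \<in> ?I)"
    proof
      assume *: "\<forall>f\<in>forms n. ?l * f \<in> ideal_piece ?X (Suc n) \<longrightarrow> f \<in> ideal_piece ?X n"
      have "f \<in> ?I" if f: "f \<in> forms n" "?l * f \<in> ?I" for f
      proof -
        have "?l * f \<in> forms (Suc n)" using forms_mult[of ?l 1 f n] f by simp
        thus ?thesis using * f by (simp only: mem_genideal_iff[OF X])
      qed
      thus ?thesis by blast
    next
      assume *: "forms (Suc n) \<subseteq> ideal_piece (insert (?l, 1) ?X) (Suc n)"
      have "\<exists>f\<in>forms n. h - ?l * f \<in> ?I" if h: "h \<in> forms (Suc n)" for h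
      proof -
        obtain u f where uf: "h = u + ?l * f" "u \<in> ideal_piece ?X (Suc n)" "f \<in> forms n"
          using ideal_piece_insert_linear[of h ?l ?X n] * h by blast
        have "u \<in> forms (Suc n)" using ideal_piece_forms[OF X] uf by blast
        hence "u \<in> ?I" using uf mem_genideal_iff[OF X] by blast
        thus ?thesis using uf by (intro bexI[of _ f]) simp_all
      qed
      thus ?thesis by blast
    qed
  qed
  ultimately show ?thesis unfolding has_WLP_def for_general_linear_form_def by blast
qed

(* The four variables are indexed by the four-element numeral type 4, whose elements
   1, 2, 3, 4 are pairwise distinct (arithmetic is modulo 4, so 4 = 0). *)
theorem theorem3p6:
  fixes a2 a3 a4 a5 :: nat
  assumes "a2 > 0" and "a3 > 0" and "a4 > 0" and "a5 > 0"
  shows "for_general_linear_form (\<lambda>L :: (4, 'k::field_char_0) mpoly.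
    has_WLP (Idl\<^bsub>poly_ring\<^esub> {Var 1 ^ 2, Var 2 ^ a2, Var 3 ^ a3, Var 4 ^ a4, L ^ a5}))"
proof -
  define e :: "4 \<Rightarrow> 4 \<Rightarrow> 'k" where "e p i = (if i = p then 1 else 0)" for p i
  define U where "U = {c. \<forall>v\<in>range e. (\<Sum>i\<in>UNIV. v i * c i) \<noteq> 0}"
  have U: "c \<in> U \<longleftrightarrow> (\<forall>i. c i \<noteq> 0)" for c
    by (auto simp: U_def e_def if_distrib[of "\<lambda>x. x * _"] cong: if_cong)
  have "zariski_open U" unfolding U_def by (rule zariski_open_hyperplanes) simp
  moreover have "(\<lambda>_. 1) \<in> U" by (simp add: U)
  moreover have "has_WLP (Idl\<^bsub>poly_ring\<^esub>
      {Var 1 ^ 2, Var 2 ^ a2, Var 3 ^ a3, Var 4 ^ a4, linear_form b ^ a5})" if "b \<in> U" for b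
  proof -
    define a :: "4 \<Rightarrow> nat" where "a k = (if k = 1 then a5 else if k = 2 then a2 else if k = 3 then a3 else a4)" for k
    have "fst ` insert ((Var 1)\<^sup>2, 2) (range (\<lambda>k. ((if k = 1 then linear_form b else Var k) ^ a k, a k))) =
        {Var 1 ^ 2, Var 2 ^ a2, Var 3 ^ a3, Var 4 ^ a4, linear_form b ^ a5}"
      unfolding UNIV_4 by (auto simp: a_def)
    thus ?thesis using has_WLP_all_nonzero[of b a] that U by simp
  qed
  ultimately show ?thesis unfolding for_general_linear_form_def by blast
qed

end
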